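(* A self-dual full vertex operator algebra $F$ is QP-generated if and only if the following conditions hold: 1. $F_{h,\bar h}=0$ if $h\in\frac12\mathbb Z_{<0}$ or $\bar h\in\frac12\mathbb Z_{<0}$; 2. $L(1)F_{1,n}=0$ and $\bar L(1)F_{n,1}=0$ for any $n\in\mathbb Z$; 3. $L(-1)F_{0,n}=0$ and $\bar L(-1)F_{n,0}=0$ for any $n\in\mathbb Z$.
   Context: **Conventions.** $z,\bar z$ are independent formal variables, $\underline z=(z,\bar z)$, and $|z|$ stands for $z\bar z$ in exponents, so $|z|^r=z^r\bar z^r$. For a vector space $V$, $V[[z,\bar z,|z|^{\mathbb R}]]$ is the set of formal sums $\sum_{r,s\in\mathbb R}a_{r,s}z^r\bar z^s$ with countable support and $a_{r,s}=0$ unless $r-s\in\mathbb Z$; $V((z,\bar z,|z|^{\mathbb R}))$ is the subspace of those for which there is $N$ with $a_{r,s}=0$ unless $r,s\ge N$. **Function spaces.** $F_{0,1,\infty}$ is the space of real analytic functions $f:\mathbb CP^1\setminus\{0,1,\infty\}\to\mathbb C$ with conformal singularities at $0,1,\infty$: for each $\alpha\in\{0,1,\infty\}$ and each holomorphic chart $\chi$ at $\alpha$ with $\chi(\alpha)=0$ there is a series in $\mathbb C((p,\bar p,|p|^{\mathbb R}))$ converging absolutely and compactly to $f\circ\chi^{-1}(p)$ in some punctured disc around $p=0$. For $\chi\in\{p,1/p,1-1/p\}$ ($p$ the standard coordinate) this uniquely determined series is denoted $j(\chi,f)$. $\mathrm{GCor}_2$ is the complex span of the functions on $Y_2=\{(z_1,z_2)\in\mathbb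 C^2: z_1\ne z_2, z_1\ne0,z_2\neq 0\}$ $$\mu=z_1^{\alpha_1}z_2^{\alpha_2}(z_1-z_2)^{\alpha_{12}}\bar z_1^{\beta_1}\bar z_2^{\beta_2}(\bar z_1-\bar z_2)^{\beta_{12}}f(z_2/z_1),$$ $f\in F_{0,1,\infty}$, $\alpha$'s, $\beta$'s real with $\alpha_1-\beta_1,\alpha_2-\beta_2,\alpha_{12}-\beta_{12}\in\mathbb Z$. Its expansions, extended linearly, are: $\mu|_{|z_1|>|z_2|}$: expand $(z_1-z_2)^{\alpha_{12}}(\bar z_1-\bar z_2)^{\beta_{12}}$ binomially in non-negative powers of $z_2/z_1,\bar z_2/\bar z_1$ and replace $f(z_2/z_1)$ by $j(p,f)$ at $p=z_2/z_1$; $\mu|_{|z_2|>|z_1|}$: expand in non-negative powers of $z_1/z_2,\bar z_1/\bar z_2$ (with sign $(-1)^{\alpha_{12}-\beta_{12}}$) and replace $f(z_2/z_1)$ by $j(p^{-1},f)$ at $p=z_1/z_2$; $\mu|_{|z_2|>|z_1-z_2|}$: put $z_1=z_2+z_0$, expand $(z_2+z_0)^{\alpha_1}(\bar z_2+\bar z_0)^{\beta_1}$ in non-negative powers of $z_0/z_2,\bar z_0/\bar z_2$ and replace $f(z_2/z_1)$ by $j(1-p^{-1},f)$ at $p=-z_0/z_2$. **Full vertex algebra.** For $F=\bigoplus_{h,\bar h\in\mathbb R}F_{h,\bar h}$ put $F^\vee=\bigoplus F_{h,\bar h}^*$. A full vertex algebra is such an $F$ over $\mathbb C$ with $Y(-,\underline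 z):F\to\mathrm{End}(F)[[z,\bar z,|z|^{\mathbb R}]]$, $Y(a,\underline z)=\sum_{r,s\in\mathbb R}a(r,s)z^{-r-1}\bar z^{-s-1}$, and $\mathbf 1\in F_{0,0}$ such that: (FV1) for all $a,b$ there is $N$ with $a(r,s)b=0$ if $r\ge N$ or $s\ge N$; (FV2) $F_{h,\bar h}=0$ unless $h-\bar h\in\mathbb Z$; (FV3) $Y(a,\underline z)\mathbf 1\in F[[z,\bar z]]$ with constant term $a$; (FV4) $Y(\mathbf 1,\underline z)=\mathrm{id}$; (FV5) for all $a,b,c\in F$, $u\in F^\vee$ there is $\mu\in\mathrm{GCor}_2$ with $u(Y(a,\underline z_1)Y(b,\underline z_2)c)=\mu|_{|z_1|>|z_2|}$, $u(Y(Y(a,\underline z_0)b,\underline z_2)c)=\mu|_{|z_2|>|z_1-z_2|}$ ($z_0=z_1-z_2$), $u(Y(b,\underline z_2)Y(a,\underline z_1)c)=\mu|_{|z_2|>|z_1|}$; (FV6) $F_{h,\bar h}(r,s)F_{h',\bar h'}\subset F_{h+h'-r-1,\bar h+\bar h'-s-1}$. Define $D,\bar D\in\mathrm{End}F$ by $Y(a,\underline z)\mathbf 1=a+Da\,z+\bar Da\,\bar z+\cdots$. **Full vertex operator algebra.** A full vertex algebra $F$ with $\omega,\bar\omega\in F$, $\bar D\omega=0$, $D\bar\omega=0$, such that $L(n)=\omega(n+1,-1)$ and $\bar L(n)=\bar\omega(-1,n+1)$ satisfy: $[L(n),L(m)]=(n-m)L(n+m)+\frac{n^3-n}{12}\delta_{n+m,0}c$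 and $[\bar L(n),\bar L(m)]=(n-m)\bar L(n+m)+\frac{n^3-n}{12}\delta_{n+m,0}\bar c$ for some $c,\bar c\in\mathbb C$; $D=L(-1)$, $\bar D=\bar L(-1)$; $L(0)=h$, $\bar L(0)=\bar h$ on $F_{h,\bar h}$; $\dim F_{h,\bar h}<\infty$; there is $N\in\mathbb R$ with $F_{h,\bar h}=0$ if $h\le N$ or $\bar h\le N$. An invariant bilinear form is a bilinear form with $(Y(a,\underline z)b,c)=(b,Y(S_za,\underline z^{-1})c)$, where $S_za=\exp(zL(1)+\bar z\bar L(1))(-1)^{h-\bar h}z^{-2h}\bar z^{-2\bar h}a$ for $a\in F_{h,\bar h}$. $F$ is self-dual if it has a non-degenerate invariant bilinear form. With $QF_{h,\bar h}=\{v\in F_{h,\bar h}:L(1)v=\bar L(1)v=0\}$ and $QF=\bigoplus QF_{h,\bar h}$, $F$ is QP-generated if $F=\mathbb C[L(-1),\bar L(-1)]QF$. *)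

theory Defs
  imports "HOL-Analysis.Analysis"
begin

section \<open>Formal series in two variables with real exponents\<close>

text \<open>A series \<open>\<Sum> a\<^bsub>r,s\<^esub> z\<^sup>r zbar\<^sup>s\<close> is its coefficient function \<open>\<lambda>r s. a r s\<close>. The condition
  on supports is separated from the coefficients so that it also applies to series with
  coefficients in \<open>End F\<close>.\<close>

definition admissible_support :: "(real \<times> real) set \<Rightarrow> bool" where
  "admissible_support S \<longleftrightarrow> countable S \<and> (\<forall>(r, s) \<in> S. r - s \<in> \<int>)"

definition laurent2 :: "(real \<Rightarrow> real \<Rightarrow> complex) set" where
  "laurent2 = {a. admissible_support {(r, s). a r s \<noteq> 0} \<and>
                  (\<exists>N. \<forall>r s. a r s \<noteq> 0 \<longrightarrow> r \<ge> N \<and> s \<ge> N)}"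

text \<open>The single-valued function \<open>z\<^sup>r zbar\<^sup>s = z\<^bsup>r-s\<^esup> (z zbar)\<^sup>s\<close> for \<open>r - s \<in> \<int>\<close> and \<open>z \<noteq> 0\<close>.\<close>

definition zpow :: "complex \<Rightarrow> real \<Rightarrow> real \<Rightarrow> complex" where
  "zpow z r s = (z powi \<lfloor>r - s\<rfloor>) * complex_of_real (cmod z powr (2 * s))"

definition parity_sign :: "real \<Rightarrow> complex" where
  "parity_sign x = (- 1) powi \<lfloor>x\<rfloor>"

definition converges_abs_compactly ::
    "(real \<Rightarrow> real \<Rightarrow> complex) \<Rightarrow> (complex \<Rightarrow> complex) \<Rightarrow> complex set \<Rightarrow> bool" where
  "converges_abs_compactly a g U \<longleftrightarrow>
     (\<forall>p\<in>U. ((\<lambda>(r, s). a r s * zpow p r s) has_sum g p) UNIV) \<and>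
     (\<forall>K. compact K \<and> K \<subseteq> U \<longrightarrow>
        (\<exists>G. uniform_limit K (\<lambda>S p. \<Sum>(r, s)\<in>S. norm (a r s * zpow p r s)) G
               (finite_subsets_at_top UNIV)))"


section \<open>Functions on the thrice punctured sphere\<close>

definition real_analytic_at :: "(complex \<Rightarrow> complex) \<Rightarrow> complex \<Rightarrow> bool" where
  "real_analytic_at f w \<longleftrightarrow>
     (\<exists>\<epsilon>>0. \<exists>a :: nat \<Rightarrow> nat \<Rightarrow> complex. \<forall>z\<in>ball w \<epsilon>.
        ((\<lambda>(m, n). a m n * complex_of_real (Re (z - w) ^ m * Im (z - w) ^ n)) has_sum f z) UNIV)"

definition holomorphic_chart :: "complex \<Rightarrow> complex set \<Rightarrow> (complex \<Rightarrow> complex) \<Rightarrow> bool" where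
  "holomorphic_chart \<alpha> U \<kappa> \<longleftrightarrow>
     open U \<and> \<alpha> \<in> U \<and> \<kappa> holomorphic_on U \<and> inj_on \<kappa> U \<and> \<kappa> \<alpha> = 0"

definition conformal_singularity_at :: "(complex \<Rightarrow> complex) \<Rightarrow> complex \<Rightarrow> bool" where
  "conformal_singularity_at f \<alpha> \<longleftrightarrow>
     (\<forall>U \<kappa>. holomorphic_chart \<alpha> U \<kappa> \<longrightarrow>
        (\<exists>a\<in>laurent2. \<exists>\<epsilon>>0. ball 0 \<epsilon> \<subseteq> \<kappa> ` U \<and>
           converges_abs_compactly a (\<lambda>p. f (inv_into U \<kappa> p)) (ball 0 \<epsilon> - {0})))"

text \<open>A function on the sphere without \<open>0, 1, \<infinity>\<close> is a function on \<open>\<complex>\<close> whose values at \<open>0\<close> and \<open>1\<close>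
  are irrelevant. The charts at \<open>\<infinity>\<close> are the charts at \<open>0\<close> in the coordinate \<open>w = 1/z\<close>.\<close>

definition F_0_1_inf :: "(complex \<Rightarrow> complex) set" where
  "F_0_1_inf = {f. (\<forall>w. w \<noteq> 0 \<and> w \<noteq> 1 \<longrightarrow> real_analytic_at f w) \<and>
                   conformal_singularity_at f 0 \<and>
                   conformal_singularity_at f 1 \<and>
                   conformal_singularity_at (\<lambda>w. f (1 / w)) 0}"

text \<open>\<open>j_expansion \<psi> f\<close> is \<open>j(\<kappa>, f)\<close> for the inverse \<open>\<psi> = \<kappa>\<^bsup>-1\<^esup>\<close> of the chart:
  \<open>\<psi> q = q\<close> for \<open>\<kappa> = p\<close>, \<open>\<psi> q = 1 / q\<close> for \<open>\<kappa> = 1 / p\<close> and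
  \<open>\<psi> q = 1 / (1 - q)\<close> for \<open>\<kappa> = 1 - 1 / p\<close>. For \<open>f \<in> F_0_1_inf\<close> there is exactly one such series.\<close>

definition j_expansion ::
    "(complex \<Rightarrow> complex) \<Rightarrow> (complex \<Rightarrow> complex) \<Rightarrow> real \<Rightarrow> real \<Rightarrow> complex" where
  "j_expansion \<psi> f =
     (SOME a. a \<in> laurent2 \<and>
        (\<exists>\<epsilon>>0. converges_abs_compactly a (\<lambda>q. f (\<psi> q)) (ball 0 \<epsilon> - {0})))"


section \<open>Generalized two-point correlation functions and their expansions\<close>

text \<open>Extended by zero outside of \<open>Y\<^sub>2\<close>, so that equality of functions is equality on \<open>Y\<^sub>2\<close>.\<close>

definition gcor2_fun ::
    "real \<Rightarrow> real \<Rightarrow> real \<Rightarrow> real \<Rightarrow> real \<Rightarrow> real \<Rightarrow> (complex \<Rightarrow> complex) \<Rightarrow>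
     complex \<times> complex \<Rightarrow> complex" where
  "gcor2_fun \<alpha>1 \<alpha>2 \<alpha>12 \<beta>1 \<beta>2 \<beta>12 f = (\<lambda>(z1, z2).
     if z1 \<noteq> z2 \<and> z1 \<noteq> 0 \<and> z2 \<noteq> 0
     then zpow z1 \<alpha>1 \<beta>1 * zpow z2 \<alpha>2 \<beta>2 * zpow (z1 - z2) \<alpha>12 \<beta>12 * f (z2 / z1) else 0)"

text \<open>Coefficient of \<open>x\<^sup>r xbar\<^sup>s\<close> in \<open>(1 + \<epsilon> x)\<^sup>A (1 + \<epsilon> xbar)\<^sup>B (\<Sum> a\<^bsub>r,s\<^esub> x\<^sup>r xbar\<^sup>s)\<close>; the sum is finite
  for \<open>a \<in> laurent2\<close>.\<close>

definition binomial_times ::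
    "complex \<Rightarrow> real \<Rightarrow> real \<Rightarrow> (real \<Rightarrow> real \<Rightarrow> complex) \<Rightarrow> real \<Rightarrow> real \<Rightarrow> complex" where
  "binomial_times \<epsilon> A B a r s =
     (\<Sum>(i, j) | a (r - real i) (s - real j) \<noteq> 0.
        \<epsilon> ^ (i + j) * complex_of_real ((A gchoose i) * (B gchoose j)) * a (r - real i) (s - real j))"

text \<open>A series in two pairs of variables is a function of the four exponents, in the order
  \<open>z\<^sub>1, zbar\<^sub>1, z\<^sub>2, zbar\<^sub>2\<close> (in \<open>expand_2_12\<close>: \<open>z\<^sub>0, zbar\<^sub>0, z\<^sub>2, zbar\<^sub>2\<close>).\<close>

type_synonym series4 = "real \<Rightarrow> real \<Rightarrow> real \<Rightarrow> real \<Rightarrow> complex"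

text \<open>Region \<open>|z\<^sub>1| > |z\<^sub>2|\<close>, with \<open>x = z\<^sub>2 / z\<^sub>1\<close>:
  \<open>z\<^sub>1\<^bsup>\<alpha>1+\<alpha>12\<^esup> z\<^sub>2\<^bsup>\<alpha>2\<^esup> (1 - x)\<^bsup>\<alpha>12\<^esup>\<close> times the conjugate factors times \<open>j(p, f)\<close> at \<open>p = x\<close>.\<close>

definition expand_1_2 ::
    "real \<Rightarrow> real \<Rightarrow> real \<Rightarrow> real \<Rightarrow> real \<Rightarrow> real \<Rightarrow> (complex \<Rightarrow> complex) \<Rightarrow> series4" where
  "expand_1_2 \<alpha>1 \<alpha>2 \<alpha>12 \<beta>1 \<beta>2 \<beta>12 f = (\<lambda>r1 s1 r2 s2.
     if r1 + r2 = \<alpha>1 + \<alpha>2 + \<alpha>12 \<and> s1 + s2 = \<beta>1 + \<beta>2 + \<beta>12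
     then binomial_times (- 1) \<alpha>12 \<beta>12 (j_expansion (\<lambda>q. q) f) (r2 - \<alpha>2) (s2 - \<beta>2)
     else 0)"

text \<open>Region \<open>|z\<^sub>2| > |z\<^sub>1|\<close>, with \<open>y = z\<^sub>1 / z\<^sub>2\<close>: \<open>(-1)\<^bsup>\<alpha>12-\<beta>12\<^esup> z\<^sub>1\<^bsup>\<alpha>1\<^esup> z\<^sub>2\<^bsup>\<alpha>2+\<alpha>12\<^esup> (1 - y)\<^bsup>\<alpha>12\<^esup>\<close> times the
  conjugate factors times \<open>j(1/p, f)\<close> at \<open>y\<close>.\<close>

definition expand_2_1 ::
    "real \<Rightarrow> real \<Rightarrow> real \<Rightarrow> real \<Rightarrow> real \<Rightarrow> real \<Rightarrow> (complex \<Rightarrow> complex) \<Rightarrow> series4" where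
  "expand_2_1 \<alpha>1 \<alpha>2 \<alpha>12 \<beta>1 \<beta>2 \<beta>12 f = (\<lambda>r1 s1 r2 s2.
     if r1 + r2 = \<alpha>1 + \<alpha>2 + \<alpha>12 \<and> s1 + s2 = \<beta>1 + \<beta>2 + \<beta>12
     then parity_sign (\<alpha>12 - \<beta>12) *
          binomial_times (- 1) \<alpha>12 \<beta>12 (j_expansion (\<lambda>q. 1 / q) f) (r1 - \<alpha>1) (s1 - \<beta>1)
     else 0)"

text \<open>Region \<open>|z\<^sub>2| > |z\<^sub>1 - z\<^sub>2|\<close>, with \<open>z\<^sub>1 = z\<^sub>2 + z\<^sub>0\<close> and \<open>x = z\<^sub>0 / z\<^sub>2\<close>:
  \<open>z\<^sub>0\<^bsup>\<alpha>12\<^esup> z\<^sub>2\<^bsup>\<alpha>1+\<alpha>2\<^esup> (1 + x)\<^bsup>\<alpha>1\<^esup>\<close> times the conjugate factors times \<open>j(1 - 1/p, f)\<close> at \<open>- x\<close>;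
  substituting \<open>- x\<close> multiplies the coefficient of \<open>x\<^sup>r xbar\<^sup>s\<close> by \<open>(-1)\<^bsup>r-s\<^esup>\<close>.\<close>

definition expand_2_12 ::
    "real \<Rightarrow> real \<Rightarrow> real \<Rightarrow> real \<Rightarrow> real \<Rightarrow> real \<Rightarrow> (complex \<Rightarrow> complex) \<Rightarrow> series4" where
  "expand_2_12 \<alpha>1 \<alpha>2 \<alpha>12 \<beta>1 \<beta>2 \<beta>12 f = (\<lambda>r0 s0 r2 s2.
     if r0 + r2 = \<alpha>1 + \<alpha>2 + \<alpha>12 \<and> s0 + s2 = \<beta>1 + \<beta>2 + \<beta>12
     then binomial_times 1 \<alpha>1 \<beta>1
            (\<lambda>r s. parity_sign (r - s) * j_expansion (\<lambda>q. 1 / (1 - q)) f r s)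
            (r0 - \<alpha>12) (s0 - \<beta>12)
     else 0)"

text \<open>\<open>GCor2 \<mu> A B C\<close>: the function \<open>\<mu>\<close> belongs to the complex span \<open>GCor\<^sub>2\<close> of the functions
  \<open>gcor2_fun\<close>, and its expansions in \<open>|z\<^sub>1| > |z\<^sub>2|\<close>, \<open>|z\<^sub>2| > |z\<^sub>1 - z\<^sub>2|\<close>, \<open>|z\<^sub>2| > |z\<^sub>1|\<close> are \<open>A\<close>, \<open>B\<close>,
  \<open>C\<close>. The graph of the linear extension is the span of the graph on the spanning functions.\<close>

inductive GCor2 :: "(complex \<times> complex \<Rightarrow> complex) \<Rightarrow> series4 \<Rightarrow> series4 \<Rightarrow> series4 \<Rightarrow> bool" where
  GCor2_gen:
    "\<lbrakk>\<alpha>1 - \<beta>1 \<in> \<int>; \<alpha>2 - \<beta>2 \<in> \<int>; \<alpha>12 - \<beta>12 \<in> \<int>; f \<in> F_0_1_inf\<rbrakk> \<Longrightarrow>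
     GCor2 (gcor2_fun \<alpha>1 \<alpha>2 \<alpha>12 \<beta>1 \<beta>2 \<beta>12 f)
       (expand_1_2 \<alpha>1 \<alpha>2 \<alpha>12 \<beta>1 \<beta>2 \<beta>12 f)
       (expand_2_12 \<alpha>1 \<alpha>2 \<alpha>12 \<beta>1 \<beta>2 \<beta>12 f)
       (expand_2_1 \<alpha>1 \<alpha>2 \<alpha>12 \<beta>1 \<beta>2 \<beta>12 f)"
| GCor2_zero:
    "GCor2 (\<lambda>_. 0) (\<lambda>_ _ _ _. 0) (\<lambda>_ _ _ _. 0) (\<lambda>_ _ _ _. 0)"
| GCor2_add:
    "\<lbrakk>GCor2 \<mu> A B C; GCor2 \<mu>' A' B' C'\<rbrakk> \<Longrightarrow>
     GCor2 (\<lambda>z. \<mu> z + \<mu>' z)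
       (\<lambda>r s t u. A r s t u + A' r s t u)
       (\<lambda>r s t u. B r s t u + B' r s t u)
       (\<lambda>r s t u. C r s t u + C' r s t u)"
| GCor2_scale:
    "GCor2 \<mu> A B C \<Longrightarrow>
     GCor2 (\<lambda>z. k * \<mu> z)
       (\<lambda>r s t u. k * A r s t u) (\<lambda>r s t u. k * B r s t u) (\<lambda>r s t u. k * C r s t u)"


section \<open>Full vertex algebras\<close>

definition direct_sum_grading ::
    "(complex \<Rightarrow> 'v::ab_group_add \<Rightarrow> 'v) \<Rightarrow> (real \<Rightarrow> real \<Rightarrow> 'v set) \<Rightarrow> bool" where
  "direct_sum_grading smul F \<longleftrightarrow>
     (\<forall>h hb. module.subspace smul (F h hb)) \<and>
     (\<forall>v. \<exists>!c :: real \<times> real \<Rightarrow> 'v.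
        finite {p. c p \<noteq> 0} \<and> (\<forall>h hb. c (h, hb) \<in> F h hb) \<and> (\<Sum>p | c p \<noteq> 0. c p) = v)"

text \<open>\<open>F\<^sup>\<or> = \<Oplus> F\<^bsub>h,hb\<^esub>\<^sup>*\<close>, as functionals on \<open>F\<close> that vanish on almost all homogeneous components.\<close>

definition restricted_dual ::
    "(complex \<Rightarrow> 'v::ab_group_add \<Rightarrow> 'v) \<Rightarrow> (real \<Rightarrow> real \<Rightarrow> 'v set) \<Rightarrow> ('v \<Rightarrow> complex) set" where
  "restricted_dual smul F =
     {u. Vector_Spaces.linear smul (*) u \<and> finite {(h, hb). \<exists>v\<in>F h hb. u v \<noteq> 0}}"

text \<open>The vertex operator is given by its modes: \<open>Y a r s b\<close> is \<open>a(r,s)b\<close>, the coefficient of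
  \<open>z\<^bsup>-r-1\<^esup> zbar\<^bsup>-s-1\<^esup>\<close> in \<open>Y(a,z)b\<close>.\<close>

locale full_vertex_algebra = vector_space smul
  for smul :: "complex \<Rightarrow> 'v::ab_group_add \<Rightarrow> 'v"
    and F :: "real \<Rightarrow> real \<Rightarrow> 'v set"
    and Y :: "'v \<Rightarrow> real \<Rightarrow> real \<Rightarrow> 'v \<Rightarrow> 'v"
    and vac :: 'v +
  assumes grading: "direct_sum_grading smul F"
    and Y_linear_left: "Vector_Spaces.linear smul smul (\<lambda>a. Y a r s b)"
    and Y_linear_right: "Vector_Spaces.linear smul smul (\<lambda>b. Y a r s b)"
    and Y_support: "admissible_support {(r, s). \<exists>b. Y a (- r - 1) (- s - 1) b \<noteq> 0}"
    and vac_degree: "vac \<in> F 0 0"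
    and FV1: "\<exists>N. \<forall>r s. r \<ge> N \<or> s \<ge> N \<longrightarrow> Y a r s b = 0"
    and FV2: "h - hb \<notin> \<int> \<Longrightarrow> F h hb = {0}"
    and FV3_support: "Y a (- r - 1) (- s - 1) vac \<noteq> 0 \<Longrightarrow> r \<in> \<nat> \<and> s \<in> \<nat>"
    and FV3_constant_term: "Y a (- 1) (- 1) vac = a"
    and FV4: "Y vac r s b = (if r = - 1 \<and> s = - 1 then b else 0)"
    and FV5: "u \<in> restricted_dual smul F \<Longrightarrow>
      \<exists>\<mu>. GCor2 \<mu>
        (\<lambda>r1 s1 r2 s2. u (Y a (- r1 - 1) (- s1 - 1) (Y b (- r2 - 1) (- s2 - 1) c)))
        (\<lambda>r0 s0 r2 s2. u (Y (Y a (- r0 - 1) (- s0 - 1) b) (- r2 - 1) (- s2 - 1) c))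
        (\<lambda>r1 s1 r2 s2. u (Y b (- r2 - 1) (- s2 - 1) (Y a (- r1 - 1) (- s1 - 1) c)))"
    and FV6: "\<lbrakk>a \<in> F h hb; b \<in> F h' hb'\<rbrakk> \<Longrightarrow>
      Y a r s b \<in> F (h + h' - r - 1) (hb + hb' - s - 1)"

definition D_op :: "('v \<Rightarrow> real \<Rightarrow> real \<Rightarrow> 'v \<Rightarrow> 'v) \<Rightarrow> 'v \<Rightarrow> 'v \<Rightarrow> 'v" where
  "D_op Y vac a = Y a (- 2) (- 1) vac"

definition Dbar_op :: "('v \<Rightarrow> real \<Rightarrow> real \<Rightarrow> 'v \<Rightarrow> 'v) \<Rightarrow> 'v \<Rightarrow> 'v \<Rightarrow> 'v" where
  "Dbar_op Y vac a = Y a (- 1) (- 2) vac"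


section \<open>Full vertex operator algebras\<close>

definition L_op :: "('v \<Rightarrow> real \<Rightarrow> real \<Rightarrow> 'v \<Rightarrow> 'v) \<Rightarrow> 'v \<Rightarrow> int \<Rightarrow> 'v \<Rightarrow> 'v" where
  "L_op Y \<omega> n = Y \<omega> (of_int (n + 1)) (- 1)"

definition Lbar_op :: "('v \<Rightarrow> real \<Rightarrow> real \<Rightarrow> 'v \<Rightarrow> 'v) \<Rightarrow> 'v \<Rightarrow> int \<Rightarrow> 'v \<Rightarrow> 'v" where
  "Lbar_op Y \<omega>b n = Y \<omega>b (- 1) (of_int (n + 1))"

definition virasoro_relations ::
    "(complex \<Rightarrow> 'v::ab_group_add \<Rightarrow> 'v) \<Rightarrow> (int \<Rightarrow> 'v \<Rightarrow> 'v) \<Rightarrow> complex \<Rightarrow> bool" where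
  "virasoro_relations smul L c \<longleftrightarrow>
     (\<forall>n m v. L n (L m v) - L m (L n v) =
        smul (of_int (n - m)) (L (n + m) v) +
        smul (of_int (n ^ 3 - n) / 12 * (if n + m = 0 then 1 else 0) * c) v)"

locale full_vertex_operator_algebra = full_vertex_algebra smul F Y vac
  for smul :: "complex \<Rightarrow> 'v::ab_group_add \<Rightarrow> 'v"
    and F :: "real \<Rightarrow> real \<Rightarrow> 'v set"
    and Y :: "'v \<Rightarrow> real \<Rightarrow> real \<Rightarrow> 'v \<Rightarrow> 'v"
    and vac :: 'v
    and \<omega> :: 'v
    and \<omega>b :: 'v +
  assumes Dbar_\<omega>: "Dbar_op Y vac \<omega> = 0"
    and D_\<omega>b: "D_op Y vac \<omega>b = 0"
    and virasoro: "\<exists>c. virasoro_relations smul (L_op Y \<omega>) c"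
    and virasoro_bar: "\<exists>cb. virasoro_relations smul (Lbar_op Y \<omega>b) cb"
    and D_eq: "D_op Y vac = L_op Y \<omega> (- 1)"
    and Dbar_eq: "Dbar_op Y vac = Lbar_op Y \<omega>b (- 1)"
    and L0: "v \<in> F h hb \<Longrightarrow> L_op Y \<omega> 0 v = smul (of_real h) v"
    and Lbar0: "v \<in> F h hb \<Longrightarrow> Lbar_op Y \<omega>b 0 v = smul (of_real hb) v"
    and finite_dim: "\<exists>B. finite B \<and> F h hb = module.span smul B"
    and bounded_below: "\<exists>N. \<forall>h hb. h \<le> N \<or> hb \<le> N \<longrightarrow> F h hb = {0}"

text \<open>\<open>word_sum A B i j\<close> is the coefficient of \<open>z\<^sup>i zbar\<^sup>j\<close> in \<open>(z A + zbar B)\<^bsup>i+j\<^esup>\<close>, without assuming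
  that \<open>A\<close> and \<open>B\<close> commute.\<close>

fun word_sum :: "('v::ab_group_add \<Rightarrow> 'v) \<Rightarrow> ('v \<Rightarrow> 'v) \<Rightarrow> nat \<Rightarrow> nat \<Rightarrow> 'v \<Rightarrow> 'v" where
  "word_sum A B 0 0 v = v"
| "word_sum A B (Suc i) 0 v = A (word_sum A B i 0 v)"
| "word_sum A B 0 (Suc j) v = B (word_sum A B 0 j v)"
| "word_sum A B (Suc i) (Suc j) v = A (word_sum A B i (Suc j) v) + B (word_sum A B (Suc i) j v)"

text \<open>Coefficient of \<open>z\<^bsup>i-2h\<^esup> zbar\<^bsup>j-2hb\<^esup>\<close> in \<open>S\<^sub>z a\<close>, for \<open>a \<in> F h hb\<close>.\<close>

definition S_coeff ::
    "(complex \<Rightarrow> 'v::ab_group_add \<Rightarrow> 'v) \<Rightarrow> ('v \<Rightarrow> real \<Rightarrow> real \<Rightarrow> 'v \<Rightarrow> 'v) \<Rightarrow> 'v \<Rightarrow> 'v \<Rightarrow>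
     real \<Rightarrow> real \<Rightarrow> 'v \<Rightarrow> nat \<Rightarrow> nat \<Rightarrow> 'v" where
  "S_coeff smul Y \<omega> \<omega>b h hb a i j =
     smul (parity_sign (h - hb) / fact (i + j)) (word_sum (L_op Y \<omega> 1) (Lbar_op Y \<omega>b 1) i j a)"

text \<open>Invariance compares the coefficients of \<open>z\<^sup>p zbar\<^sup>q\<close> in \<open>(Y(a,z)b, c) = (b, Y(S\<^sub>z a, z\<^bsup>-1\<^esup>)c)\<close>;
  since \<open>Y(a', z\<^bsup>-1\<^esup>) = \<Sum> a'(r,s) z\<^bsup>r+1\<^esup> zbar\<^bsup>s+1\<^esup>\<close>, the mode of the \<open>(i,j)\<close> term of \<open>S\<^sub>z a\<close> satisfies
  \<open>r + 1 + i - 2h = p\<close> and \<open>s + 1 + j - 2hb = q\<close>. In a full vertex operator algebra only finitely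
  many terms of \<open>S\<^sub>z a\<close> are nonzero, as the weights are bounded below.\<close>

definition invariant_bilinear_form ::
    "(complex \<Rightarrow> 'v::ab_group_add \<Rightarrow> 'v) \<Rightarrow> (real \<Rightarrow> real \<Rightarrow> 'v set) \<Rightarrow>
     ('v \<Rightarrow> real \<Rightarrow> real \<Rightarrow> 'v \<Rightarrow> 'v) \<Rightarrow> 'v \<Rightarrow> 'v \<Rightarrow> ('v \<Rightarrow> 'v \<Rightarrow> complex) \<Rightarrow> bool" where
  "invariant_bilinear_form smul F Y \<omega> \<omega>b form \<longleftrightarrow>
     (\<forall>w. Vector_Spaces.linear smul (*) (\<lambda>v. form v w)) \<and>
     (\<forall>v. Vector_Spaces.linear smul (*) (\<lambda>w. form v w)) \<and>
     (\<forall>h hb. \<forall>a\<in>F h hb. \<forall>b c p q.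
        form (Y a (- p - 1) (- q - 1) b) c =
        (\<Sum>(i, j) | S_coeff smul Y \<omega> \<omega>b h hb a i j \<noteq> 0.
           form b (Y (S_coeff smul Y \<omega> \<omega>b h hb a i j)
                     (p - 1 - real i + 2 * h) (q - 1 - real j + 2 * hb) c)))"

definition nondegenerate_form :: "('v::zero \<Rightarrow> 'v \<Rightarrow> complex) \<Rightarrow> bool" where
  "nondegenerate_form form \<longleftrightarrow>
     (\<forall>v. (\<forall>w. form v w = 0) \<longrightarrow> v = 0) \<and> (\<forall>w. (\<forall>v. form v w = 0) \<longrightarrow> w = 0)"

definition self_dual ::
    "(complex \<Rightarrow> 'v::ab_group_add \<Rightarrow> 'v) \<Rightarrow> (real \<Rightarrow> real \<Rightarrow> 'v set) \<Rightarrow>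
     ('v \<Rightarrow> real \<Rightarrow> real \<Rightarrow> 'v \<Rightarrow> 'v) \<Rightarrow> 'v \<Rightarrow> 'v \<Rightarrow> bool" where
  "self_dual smul F Y \<omega> \<omega>b \<longleftrightarrow>
     (\<exists>form. invariant_bilinear_form smul F Y \<omega> \<omega>b form \<and> nondegenerate_form form)"

definition QF_component ::
    "(real \<Rightarrow> real \<Rightarrow> 'v::ab_group_add set) \<Rightarrow> ('v \<Rightarrow> real \<Rightarrow> real \<Rightarrow> 'v \<Rightarrow> 'v) \<Rightarrow> 'v \<Rightarrow> 'v \<Rightarrow>
     real \<Rightarrow> real \<Rightarrow> 'v set" where
  "QF_component F Y \<omega> \<omega>b h hb = {v \<in> F h hb. L_op Y \<omega> 1 v = 0 \<and> Lbar_op Y \<omega>b 1 v = 0}"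

definition QF ::
    "(complex \<Rightarrow> 'v::ab_group_add \<Rightarrow> 'v) \<Rightarrow> (real \<Rightarrow> real \<Rightarrow> 'v set) \<Rightarrow>
     ('v \<Rightarrow> real \<Rightarrow> real \<Rightarrow> 'v \<Rightarrow> 'v) \<Rightarrow> 'v \<Rightarrow> 'v \<Rightarrow> 'v set" where
  "QF smul F Y \<omega> \<omega>b = module.span smul (\<Union>h hb. QF_component F Y \<omega> \<omega>b h hb)"

definition QP_generated ::
    "(complex \<Rightarrow> 'v::ab_group_add \<Rightarrow> 'v) \<Rightarrow> (real \<Rightarrow> real \<Rightarrow> 'v set) \<Rightarrow>
     ('v \<Rightarrow> real \<Rightarrow> real \<Rightarrow> 'v \<Rightarrow> 'v) \<Rightarrow> 'v \<Rightarrow> 'v \<Rightarrow> bool" where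
  "QP_generated smul F Y \<omega> \<omega>b \<longleftrightarrow>
     module.span smul
       {(L_op Y \<omega> (- 1) ^^ i) ((Lbar_op Y \<omega>b (- 1) ^^ j) v) | i j v. v \<in> QF smul F Y \<omega> \<omega>b} = UNIV"

end

theory Submission
  imports Defs "HOL-Complex_Analysis.Complex_Analysis"
begin

text \<open>
  Only the two commuting copies of \<open>sl\<^sub>2\<close> spanned by \<open>L(\<plusminus>1), L(0)\<close> and by their conjugates, the operator
  \<open>L(2)\<close>, and the invariant form matter. The argument has an algebraic and an analytic half.

  Algebra. Suppose that \<open>F\<close> is QP-generated, and let \<open>w = L(-1)\<^sup>n\<^sup>+\<^sup>1 v\<close> with \<open>L(1) w = 0\<close>. Since \<open>L(1)\<close> is
  adjoint to \<open>L(-1)\<close> and commutes with the conjugate copy, \<open>w\<close> is orthogonal to all descendants of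
  quasi-primary vectors, so \<open>w = 0\<close> (\<open>descendant_zero\<close>). If \<open>v\<close> has weight \<open>h = -m/2\<close> with \<open>m > 0\<close> and
  \<open>F\<close> vanishes in the weights \<open>h - 1\<close> and \<open>h - 2\<close>, then \<open>v\<close> is killed by \<open>L(1)\<close> and \<open>L(2)\<close>, and
  \<open>L(1) L(-1)\<^sup>m\<^sup>+\<^sup>1 v = 0\<close>; hence \<open>L(-1)\<^sup>m\<^sup>+\<^sup>1 v = 0\<close>. Applying \<open>L(2)\<close> gives \<open>L(-1)\<^sup>m\<^sup>-\<^sup>1 v = 0\<close>, because
  \<open>L(2) L(-1)\<^sup>m\<^sup>+\<^sup>1 v\<close> is a nonzero multiple of it, and then powers of \<open>L(1)\<close> give \<open>v = 0\<close>. As the weights are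
  bounded below, an induction on the weight proves the first condition
  (\<open>negative_half_integer_zero\<close>). For \<open>v\<close> of weight \<open>0\<close> the same orthogonality shows \<open>L(-1) v = 0\<close>, which is
  the third condition, and the second one is its adjoint.

  Conversely, let \<open>v\<close> have weight \<open>h\<close>. By induction \<open>L(1) v\<close> is a combination of vectors \<open>L(-1)\<^sup>i x\<close> with
  \<open>L(1) x = 0\<close>, and \<open>L(1) L(-1)\<^sup>i\<^sup>+\<^sup>1 x = (i + 1)(2h - 2 - i) L(-1)\<^sup>i x\<close>. The factor vanishes only if \<open>x\<close> has
  weight \<open>-i/2\<close>; for \<open>i > 0\<close> the first condition excludes this, and for \<open>i = 0\<close> one has \<open>h = 1\<close> and the second
  condition gives \<open>L(1) v = 0\<close>. So \<open>v\<close> can be corrected by descendants to a vector killed by \<open>L(1)\<close>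
  (\<open>generated_by_lowest\<close>). Doing this for one copy of \<open>sl\<^sub>2\<close>, and then for the other one inside the
  kernel of \<open>L(1)\<close>, shows that \<open>F\<close> is QP-generated.

  Analysis. It remains to extract from the correlation functions that \<open>[L(n), Lbar(m)] = 0\<close>. This yields
  \<open>Lbar(0) \<omega> = L(-2) Lbar(0) 1 = 0\<close>, so \<open>\<omega> \<in> F\<^bsub>2,0\<^esub>\<close>, and invariance of the form for the quasi-primary
  vector \<open>\<omega>\<close> becomes \<open>(L(n) v, w) = (v, L(-n) w)\<close>. In a fixed total degree a generalized two-point function is
  determined by a function \<open>g\<close> of \<open>w = z\<^sub>2/z\<^sub>1\<close>, analytic on \<open>\<complex> - {0, 1}\<close>, whose convergent expansions at
  \<open>0, 1, \<infinity>\<close> are the three formal expansions (\<open>GCor2_expansions\<close>). If the expansion at \<open>0\<close> is a single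
  monomial, the identity theorem makes \<open>g\<close> that monomial everywhere, which determines the other two
  expansions. With the vacuum as second vector this is the translation property \<open>Y(Dbar a, z) = \<partial>Y(a, z)/\<partial>zbar\<close>
  (and its conjugate), so that \<open>Dbar \<omega> = 0\<close> makes \<open>Y(\<omega>, z)\<close> holomorphic; for \<open>\<omega>\<close> and its conjugate it is the
  commutation relation.
\<close>


section \<open>Powers with two real exponents\<close>

lemma zpow_eq_exp:
  assumes "z \<noteq> 0" "A - B \<in> \<int>"
  shows "zpow z A B = exp (of_real A * Ln z + of_real B * cnj (Ln z))"
proof -
  obtain k :: int where k: "A - B = of_int k"
    using assms(2) by (elim Ints_cases)
  have "complex_of_real (cmod z powr (2 * B)) = exp (of_real (2 * B * Re (Ln z)))"
    using assms(1) by (simp only: exp_of_real) (simp add: powr_def)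
  also have "complex_of_real (2 * B * Re (Ln z)) = of_real B * (Ln z + cnj (Ln z))"
    by (simp add: complex_add_cnj)
  finally have norm: "complex_of_real (cmod z powr (2 * B)) = exp (of_real B * (Ln z + cnj (Ln z)))" .
  have "z powi k = exp (of_int k * Ln z)"
    using exp_power_int[of "Ln z" k] assms(1) by simp
  moreover have "complex_of_real A = of_int k + of_real B"
    using k by (metis add.commute diff_add_cancel of_real_add of_real_of_int_eq)
  ultimately show ?thesis
    unfolding zpow_def k norm by (simp add: mult_exp_exp algebra_simps)
qed

lemma zpow_nonzero: "z \<noteq> 0 \<Longrightarrow> zpow z A B \<noteq> 0"
  by (simp add: zpow_def)

lemma zpow_0_0: "z \<noteq> 0 \<Longrightarrow> zpow z 0 0 = 1"
  by (simp add: zpow_def)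

lemma zpow_one: "zpow 1 A B = 1"
  by (simp add: zpow_def)

text \<open>Only the second summand has to satisfy the integrality condition; the floor in \<open>zpow\<close> then splits.\<close>

lemma zpow_add:
  assumes "z \<noteq> 0" "A' - B' \<in> \<int>"
  shows "zpow z (A + A') (B + B') = zpow z A B * zpow z A' B'"
proof -
  obtain k :: int where k: "A' - B' = of_int k"
    using assms(2) by (elim Ints_cases)
  have "\<lfloor>A + A' - (B + B')\<rfloor> = \<lfloor>A - B\<rfloor> + k"
    using k floor_add_int[of "A - B" k] by (simp add: algebra_simps)
  then show ?thesis
    using assms(1) k
    by (simp add: zpow_def power_int_add distrib_left powr_add)
qed

lemma zpow_nat:
  assumes "z \<noteq> 0"
  shows "zpow z (real i) (real j) = z ^ i * cnj z ^ j"
proof -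
  have "complex_of_real (cmod z powr (2 * real j)) = (z * cnj z) ^ j"
    using assms
    by (metis complex_norm_square mult_2 of_nat_add of_real_power power_mult powr_realpow
        zero_less_norm_iff)
  moreover have "\<lfloor>real i - real j\<rfloor> = int i - int j"
    by linarith
  ultimately show ?thesis
    using assms by (simp add: zpow_def power_int_diff power_mult_distrib)
qed

lemma zpow_mult: "zpow (z * w) A B = zpow z A B * zpow w A B"
  by (simp add: zpow_def power_int_mult_distrib norm_mult powr_mult)

lemma zpow_inverse: "zpow (inverse z) A B = inverse (zpow z A B)"
  by (simp add: zpow_def power_int_inverse norm_inverse inverse_powr powr_minus)

lemma zpow_minus_one: "zpow (- z) A B = parity_sign (A - B) * zpow z A B"
proof -
  have "zpow (- 1) A B = parity_sign (A - B)"
    by (simp add: zpow_def parity_sign_def)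
  then show ?thesis
    using zpow_mult[of "-1" z] by simp
qed

section \<open>Analyticity along real lines and the identity theorem\<close>

text \<open>Restrictions to real lines extend holomorphically to the complexified parameter. This weak form of real
  analyticity is inherited by sums and products without any manipulation of double power series, and
  it still satisfies an identity theorem along segments.\<close>

definition line_analytic_at :: "(complex \<Rightarrow> complex) \<Rightarrow> complex \<Rightarrow> bool" where
  "line_analytic_at g w \<longleftrightarrow>
     (\<forall>d. \<exists>\<epsilon>>0. \<exists>H. H holomorphic_on ball 0 \<epsilon> \<and>
        (\<forall>t::real. \<bar>t\<bar> < \<epsilon> \<longrightarrow> H (of_real t) = g (w + of_real t * d)))"

lemma line_analytic_at_combine:
  assumes g: "line_analytic_at g w" and h: "line_analytic_at h w"
    and hol: "\<And>S G H. G holomorphic_on S \<Longrightarrow> H holomorphic_on S \<Longrightarrow> (\<lambda>z. f (G z) (H z)) holomorphic_on S"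
  shows "line_analytic_at (\<lambda>z. f (g z) (h z)) w"
  unfolding line_analytic_at_def
proof
  fix d
  obtain e1 G where G: "e1 > 0" "G holomorphic_on ball 0 e1"
    "\<And>t::real. \<bar>t\<bar> < e1 \<Longrightarrow> G (of_real t) = g (w + of_real t * d)"
    using g unfolding line_analytic_at_def by meson
  obtain e2 H where H: "e2 > 0" "H holomorphic_on ball 0 e2"
    "\<And>t::real. \<bar>t\<bar> < e2 \<Longrightarrow> H (of_real t) = h (w + of_real t * d)"
    using h unfolding line_analytic_at_def by meson
  have "(\<lambda>z. f (G z) (H z)) holomorphic_on ball 0 (min e1 e2)"
    using G(2) H(2) by (intro hol) (auto elim: holomorphic_on_subset)
  then show "\<exists>\<epsilon>>0. \<exists>H. H holomorphic_on ball 0 \<epsilon> \<and>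
        (\<forall>t::real. \<bar>t\<bar> < \<epsilon> \<longrightarrow> H (of_real t) = f (g (w + of_real t * d)) (h (w + of_real t * d)))"
    using G(1,3) H(1,3)
    by (intro exI[of _ "min e1 e2"] conjI exI[of _ "\<lambda>z. f (G z) (H z)"]) auto
qed

lemmas line_analytic_at_add =
  line_analytic_at_combine[where f = "(+)", OF _ _ holomorphic_on_add]
lemmas line_analytic_at_mult =
  line_analytic_at_combine[where f = "(*)", OF _ _ holomorphic_on_mult]

lemma line_analytic_at_const: "line_analytic_at (\<lambda>_. c) w"
  unfolding line_analytic_at_def
  by (intro allI exI[of _ 1] conjI exI[of _ "\<lambda>_. c"]) auto

lemma line_analytic_at_affine:
  assumes "line_analytic_at g (a + b * w)"
  shows "line_analytic_at (\<lambda>z. g (a + b * z)) w"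
  unfolding line_analytic_at_def
proof
  fix d
  show "\<exists>\<epsilon>>0. \<exists>H. H holomorphic_on ball 0 \<epsilon> \<and>
        (\<forall>t::real. \<bar>t\<bar> < \<epsilon> \<longrightarrow> H (of_real t) = g (a + b * (w + of_real t * d)))"
    using assms unfolding line_analytic_at_def
    by (elim allE[of _ "b * d"]) (simp add: algebra_simps)
qed

text \<open>On the line \<open>w + t d\<close> the conjugate of \<open>1 + t d/w\<close> equals \<open>1 + t cnj (d/w)\<close>, which is again holomorphic in \<open>t\<close>.\<close>

lemma line_analytic_at_zpow:
  assumes "w \<noteq> 0" "A - B \<in> \<int>"
  shows "line_analytic_at (\<lambda>z. zpow z A B) w"
  unfolding line_analytic_at_def
proof
  fix d
  define e where "e = d / w"
  define \<epsilon> where "\<epsilon> = 1 / (cmod e + 1)"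
  have "\<epsilon> > 0"
    by (simp add: \<epsilon>_def add_nonneg_pos)
  have small: "cmod (z * c) < 1" if "cmod z < \<epsilon>" "cmod c = cmod e" for z c
  proof -
    have "cmod z * (cmod e + 1) < 1"
      using that(1) by (simp add: \<epsilon>_def pos_less_divide_eq add_nonneg_pos)
    then show ?thesis
      using norm_ge_zero[of z] unfolding norm_mult that(2) distrib_left by linarith
  qed
  have slit: "1 + z \<notin> \<real>\<^sub>\<le>\<^sub>0" if "cmod z < 1" for z
  proof
    assume "1 + z \<in> \<real>\<^sub>\<le>\<^sub>0"
    then have "Re z \<le> - 1"
      by (auto simp: complex_nonpos_Reals_iff)
    then show False
      using that abs_Re_le_cmod[of z] by linarith
  qed
  define H where "H z = zpow w A B * exp (of_real A * Ln (1 + z * e) + of_real B * Ln (1 + z * cnj e))" for z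
  have "H holomorphic_on ball 0 \<epsilon>"
    unfolding H_def using small slit by (intro holomorphic_intros) auto
  moreover have "H (of_real t) = zpow (w + of_real t * d) A B" if "\<bar>t\<bar> < \<epsilon>" for t :: real
  proof -
    have s: "1 + of_real t * e \<notin> \<real>\<^sub>\<le>\<^sub>0"
      using small[of "of_real t" e] slit that by simp
    then have "1 + of_real t * e \<noteq> 0"
      by auto
    moreover have "cnj (Ln (1 + of_real t * e)) = Ln (1 + of_real t * cnj e)"
      using s by (simp add: cnj_Ln)
    moreover have "w + of_real t * d = w * (1 + of_real t * e)"
      using assms(1) by (simp add: e_def field_simps)
    ultimately show ?thesis
      using assms(2) by (simp add: zpow_mult zpow_eq_exp H_def)
  qed
  ultimately show "\<exists>\<epsilon>>0. \<exists>H. H holomorphic_on ball 0 \<epsilon> \<and>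
        (\<forall>t::real. \<bar>t\<bar> < \<epsilon> \<longrightarrow> H (of_real t) = zpow (w + of_real t * d) A B)"
    using \<open>\<epsilon> > 0\<close> by blast
qed

lemma has_sum_antidiagonal:
  fixes c :: "nat \<Rightarrow> nat \<Rightarrow> complex"
  assumes "((\<lambda>(m, n). c m n * x ^ (m + n)) has_sum S) UNIV"
  shows "(\<lambda>k. (\<Sum>i\<le>k. c i (k - i)) * x ^ k) sums S"
proof -
  have "((\<lambda>(k, i). c i (k - i) * x ^ k) has_sum S) (Sigma UNIV (\<lambda>k. {..k}))"
    by (subst has_sum_reindex_bij_witness[where j = "\<lambda>(k, i). (i, k - i)"
          and i = "\<lambda>(m, n). (m + n, m)" and T = UNIV and s' = S
          and h = "\<lambda>(m, n). c m n * x ^ (m + n)"]) (use assms in auto)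
  then have "((\<lambda>k. \<Sum>i\<le>k. c i (k - i) * x ^ k) has_sum S) UNIV"
    by (rule has_sum_Sigma') (auto intro: has_sum_finiteI)
  then show ?thesis
    by (auto dest!: has_sum_imp_sums simp: sum_distrib_right)
qed

lemma real_analytic_imp_line_analytic:
  assumes "real_analytic_at f w"
  shows "line_analytic_at f w"
  unfolding line_analytic_at_def
proof
  fix d
  obtain e a where "e > 0" and a: "\<And>z. z \<in> ball w e \<Longrightarrow>
        ((\<lambda>(m, n). a m n * complex_of_real (Re (z - w) ^ m * Im (z - w) ^ n)) has_sum f z) UNIV"
    using assms unfolding real_analytic_at_def by blast
  define c where "c k = (\<Sum>i\<le>k. a i (k - i) * of_real (Re d) ^ i * of_real (Im d) ^ (k - i))" for k
  define \<epsilon> where "\<epsilon> = e / (cmod d + 1)"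
  have "\<epsilon> > 0"
    using \<open>e > 0\<close> by (simp add: \<epsilon>_def add_nonneg_pos)
  have sums: "(\<lambda>k. c k * of_real t ^ k) sums f (w + of_real t * d)" if "\<bar>t\<bar> < \<epsilon>" for t :: real
  proof -
    have "\<bar>t\<bar> * (cmod d + 1) < e"
      using that by (simp add: \<epsilon>_def pos_less_divide_eq add_nonneg_pos)
    then have "\<bar>t\<bar> * cmod d < e"
      by (simp add: distrib_left)
    then have "w + of_real t * d \<in> ball w e"
      by (simp add: dist_norm norm_mult)
    then show ?thesis
      using has_sum_antidiagonal[of "\<lambda>m n. a m n * of_real (Re d) ^ m * of_real (Im d) ^ n" "of_real t"
          "f (w + of_real t * d)"] a[of "w + of_real t * d"]
      by (simp add: c_def power_mult_distrib power_add mult_ac)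
  qed
  define H where "H z = (\<Sum>k. c k * z ^ k)" for z
  have "(\<lambda>k. c k * (z - 0) ^ k) sums H z" if "z \<in> ball 0 \<epsilon>" for z
  proof -
    obtain t where "cmod z < t" "t < \<epsilon>"
      using \<open>z \<in> ball 0 \<epsilon>\<close> dense[of "cmod z" \<epsilon>] by auto
    then have "summable (\<lambda>k. c k * of_real t ^ k)"
      using sums[of t] norm_ge_zero[of z] by (simp add: sums_iff)
    then have "summable (\<lambda>k. c k * z ^ k)"
      by (rule powser_inside) (use \<open>cmod z < t\<close> norm_ge_zero[of z] in simp)
    then show ?thesis
      by (simp add: H_def summable_sums)
  qed
  then have "H holomorphic_on ball 0 \<epsilon>"
    by (rule power_series_holomorphic)
  moreover have "H (of_real t) = f (w + of_real t * d)" if "\<bar>t\<bar> < \<epsilon>" for t :: real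
    using sums[OF that] by (simp add: H_def sums_iff)
  ultimately show "\<exists>\<epsilon>>0. \<exists>H. H holomorphic_on ball 0 \<epsilon> \<and>
        (\<forall>t::real. \<bar>t\<bar> < \<epsilon> \<longrightarrow> H (of_real t) = f (w + of_real t * d))"
    using \<open>\<epsilon> > 0\<close> by blast
qed

text \<open>The supremum of the parameters up to which \<open>h\<close> vanishes along the segment is pushed to the end point by the
  identity theorem for the local holomorphic extension.\<close>

lemma line_analytic_zero_on_segment:
  assumes analytic: "\<And>t. 0 \<le> t \<Longrightarrow> t \<le> 1 \<Longrightarrow> line_analytic_at h (u + of_real t * (v - u))"
    and "\<delta> > 0" and zero: "\<And>t. 0 \<le> t \<Longrightarrow> t < \<delta> \<Longrightarrow> h (u + of_real t * (v - u)) = 0"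
  shows "h v = 0"
proof -
  define \<phi> where "\<phi> t = h (u + of_real t * (v - u))" for t
  define E where "E = {t. 0 \<le> t \<and> t \<le> 1 \<and> (\<forall>t'. 0 \<le> t' \<longrightarrow> t' \<le> t \<longrightarrow> \<phi> t' = 0)}"
  define s where "s = Sup E"
  define t0 where "t0 = min (\<delta> / 2) 1"
  have t0: "t0 \<in> E" "t0 > 0"
    using \<open>\<delta> > 0\<close> zero by (auto simp: E_def t0_def \<phi>_def)
  have bdd: "bdd_above E"
    by (rule bdd_aboveI[of _ 1]) (auto simp: E_def)
  have "t0 \<le> s"
    unfolding s_def using t0 bdd by (intro cSup_upper)
  have "s \<le> 1"
    unfolding s_def using t0 by (intro cSup_least) (auto simp: E_def)
  have below: "\<phi> t = 0" if t: "0 \<le> t" "t < s" for t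
  proof -
    obtain t' where "t' \<in> E" "t < t'"
      using t(2) t0(1) less_cSupE[of t E] unfolding s_def by blast
    then show ?thesis
      using t by (auto simp: E_def)
  qed
  obtain \<epsilon> H where H: "\<epsilon> > 0" "H holomorphic_on ball 0 \<epsilon>"
    "\<And>t::real. \<bar>t\<bar> < \<epsilon> \<Longrightarrow> H (of_real t) = h (u + of_real s * (v - u) + of_real t * (v - u))"
    using analytic[of s] \<open>t0 \<le> s\<close> \<open>t0 > 0\<close> \<open>s \<le> 1\<close> unfolding line_analytic_at_def
    by (metis less_le_trans order_less_imp_le)
  then have H_eq: "H (of_real t) = \<phi> (s + t)" if "\<bar>t\<bar> < \<epsilon>" for t :: real
    using that by (simp add: \<phi>_def algebra_simps)
  define m where "m = min \<epsilon> s"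
  have "m > 0"
    using H(1) \<open>t0 \<le> s\<close> \<open>t0 > 0\<close> by (simp add: m_def)
  define U where "U = complex_of_real ` {- m<..<0}"
  have "H z = 0" if "z \<in> ball 0 \<epsilon>" for z
  proof (rule analytic_continuation[OF H(2), where U = U and \<xi> = 0])
    show "0 islimpt U"
      unfolding islimpt_approachable
    proof safe
      fix r :: real assume "r > 0"
      define x where "x = - min m r / 2"
      have x: "x \<in> {- m<..<0}" "\<bar>x\<bar> < r"
        using \<open>m > 0\<close> \<open>r > 0\<close> by (auto simp: x_def min_def)
      then have "of_real x \<in> U" "of_real x \<noteq> (0::complex)" "dist (of_real x) (0::complex) < r"
        unfolding U_def by auto
      then show "\<exists>x'\<in>U. x' \<noteq> 0 \<and> dist x' 0 < r"
        by blast
    qed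
  next
    fix z assume "z \<in> U"
    then obtain x where x: "z = of_real x" "- m < x" "x < 0"
      by (auto simp: U_def)
    then show "H z = 0"
      using below[of "s + x"] H_eq[of x] by (auto simp: m_def)
  qed (use H(1) that in \<open>auto simp: U_def m_def\<close>)
  then have near: "\<phi> (s + t) = 0" if "\<bar>t\<bar> < \<epsilon>" for t
    using H_eq[OF that] that by simp
  have "s = 1"
  proof (rule ccontr)
    assume "s \<noteq> 1"
    define t where "t = min 1 (s + \<epsilon> / 2)"
    have "s < t"
      using \<open>s \<noteq> 1\<close> \<open>s \<le> 1\<close> H(1) by (simp add: t_def)
    have "\<phi> t' = 0" if t': "0 \<le> t'" "t' \<le> t" for t'
    proof (cases "t' < s")
      case True
      then show ?thesis
        using below t'(1) by blast
    next
      case False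
      have "t \<le> s + \<epsilon> / 2"
        by (simp add: t_def)
      then have "\<bar>t' - s\<bar> < \<epsilon>"
        using t'(2) False H(1) by linarith
      then show ?thesis
        using near[of "t' - s"] by simp
    qed
    then have "t \<in> E"
      using \<open>s < t\<close> \<open>t0 \<le> s\<close> \<open>t0 > 0\<close> by (auto simp: E_def t_def)
    then have "t \<le> s"
      unfolding s_def using bdd by (intro cSup_upper)
    then show False
      using \<open>s < t\<close> by simp
  qed
  then show ?thesis
    using near[of 0] H(1) by (simp add: \<phi>_def)
qed

text \<open>A point \<open>v\<close> is reached from the punctured disc by one segment that avoids \<open>0\<close> and \<open>1\<close>: a radial one if \<open>v\<close> is
  not real, and one that starts on the imaginary axis otherwise.\<close>

lemma line_analytic_zero:
  assumes analytic: "\<And>w. w \<noteq> 0 \<Longrightarrow> w \<noteq> 1 \<Longrightarrow> line_analytic_at h w"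
    and "\<epsilon> > 0" and zero: "\<And>w. w \<noteq> 0 \<Longrightarrow> cmod w < \<epsilon> \<Longrightarrow> h w = 0"
    and v: "v \<noteq> 0" "v \<noteq> 1"
  shows "h v = 0"
proof -
  define r where "r = min \<epsilon> (cmod v) / 2"
  have r: "0 < r" "r < \<epsilon>" "r < cmod v"
    using \<open>\<epsilon> > 0\<close> v(1) by (auto simp: r_def min_def)
  define u where "u = (if Im v = 0 then \<i> * of_real r else of_real (r / cmod v) * v)"
  have "cmod u = r"
    using r(1) v(1) by (simp add: u_def norm_mult norm_divide)
  have avoid: "u + of_real t * (v - u) \<noteq> of_real x" if t: "0 \<le> t" "t \<le> 1" and x: "x = 0 \<or> x = 1" for t x
  proof
    assume eq: "u + of_real t * (v - u) = of_real x"
    show False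
    proof (cases "Im v = 0")
      case True
      then have "t = 1"
        using arg_cong[OF eq, of Im] r(1) by (simp add: u_def algebra_simps)
      then show False
        using eq v x by auto
    next
      case False
      define q where "q = r / cmod v"
      have "0 < q" "q < 1"
        using r v(1) by (auto simp: q_def)
      have "(q + t * (1 - q)) * Im v = 0"
        using arg_cong[OF eq, of Im] False by (simp add: u_def q_def[symmetric] algebra_simps)
      moreover have "q + t * (1 - q) > 0"
        using \<open>0 < q\<close> \<open>q < 1\<close> t(1) by (simp add: add_pos_nonneg)
      ultimately show False
        using False by simp
    qed
  qed
  define \<delta> where "\<delta> = (\<epsilon> - r) / (cmod (v - u) + 1)"
  have "\<delta> > 0"
    using r by (simp add: \<delta>_def add_nonneg_pos)
  show ?thesis
  proof (rule line_analytic_zero_on_segment[where h = h and u = u and v = v and \<delta> = "min \<delta> 1"])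
    fix t :: real assume t: "0 \<le> t" "t \<le> 1"
    show "line_analytic_at h (u + of_real t * (v - u))"
      using avoid[OF t, of 0] avoid[OF t, of 1] by (intro analytic) auto
  next
    fix t :: real assume t: "0 \<le> t" "t < min \<delta> 1"
    have "t * (cmod (v - u) + 1) < \<epsilon> - r"
      using t by (simp add: \<delta>_def pos_less_divide_eq add_nonneg_pos)
    then have "t * cmod (v - u) < \<epsilon> - r"
      using t(1) by (simp add: distrib_left)
    then have "cmod (u + of_real t * (v - u)) < \<epsilon>"
      using norm_triangle_ineq[of u "of_real t * (v - u)"] \<open>cmod u = r\<close> t(1) by (simp add: norm_mult)
    then show "h (u + of_real t * (v - u)) = 0"
      using avoid[of t 0] t by (intro zero) auto
  qed (use \<open>\<delta> > 0\<close> in simp)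
qed

section \<open>Convergent expansions of generalized two-point functions\<close>

lemma has_sum_product_complex:
  fixes f :: "'a \<Rightarrow> complex" and g :: "'b \<Rightarrow> complex"
  assumes f: "(f has_sum F) A" and g: "(g has_sum G) B"
  shows "((\<lambda>(x, y). f x * g y) has_sum (F * G)) (A \<times> B)"
proof (rule has_sum_SigmaI[where g = "\<lambda>x. f x * G"])
  have "(\<lambda>x. norm (f x)) summable_on A" "(\<lambda>x. norm (g x)) summable_on B"
    using f g by (auto simp: summable_on_iff_abs_summable_on_complex[symmetric] dest: has_sum_imp_summable)
  then have "(\<lambda>z. norm (case z of (x, y) \<Rightarrow> f x * g y)) summable_on A \<times> B"
    unfolding Infinite_Sum.abs_summable_on_Sigma_iff
    by (auto simp: norm_mult infsum_cmult_right' abs_mult infsum_nonneg intro!: summable_on_cmult_right summable_on_cmult_left)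
  then show "(\<lambda>(x, y). f x * g y) summable_on A \<times> B"
    by (simp add: summable_on_iff_abs_summable_on_complex)
next
  show "((\<lambda>y. case (x, y) of (x, y) \<Rightarrow> f x * g y) has_sum f x * G) B" for x
    using has_sum_cmult_right[OF g] by simp
next
  show "((\<lambda>x. f x * G) has_sum F * G) A"
    using f by (rule has_sum_cmult_left)
qed

lemma binomial_has_sum:
  assumes "cmod x < 1"
  shows "((\<lambda>i. of_real (A gchoose i) * x ^ i) has_sum (1 + x) powr of_real A) UNIV"
proof -
  have sums: "(\<lambda>i. of_real (A gchoose i) * z ^ i) sums (1 + z) powr of_real A" if "cmod z < 1" for z :: complex
  proof -
    have "(of_real A gchoose i :: complex) = of_real (A gchoose i)" for i
      by (simp add: gbinomial_prod_rev)
    then show ?thesis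
      using gen_binomial_complex[OF that, of "of_real A"] by simp
  qed
  obtain t where t: "cmod x < t" "t < 1"
    using dense[OF assms] by blast
  have "summable (\<lambda>i. norm (of_real (A gchoose i) * x ^ i))"
  proof (rule powser_insidea)
    show "summable (\<lambda>i. of_real (A gchoose i) * complex_of_real t ^ i)"
      using sums[of "of_real t"] t norm_ge_zero[of x] by (auto simp: sums_iff)
  qed (use t norm_ge_zero[of x] in simp)
  then show ?thesis
    using sums[OF assms] by (rule norm_summable_imp_has_sum)
qed

lemma zpow_binomial_has_sum:
  assumes "cmod x < 1" "A - B \<in> \<int>"
  shows "((\<lambda>(i, j). of_real ((A gchoose i) * (B gchoose j)) * (x ^ i * cnj x ^ j))
            has_sum zpow (1 + x) A B) UNIV"
proof -
  have "1 + x \<noteq> 0"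
    using assms(1) by (metis add.commute add_eq_0_iff norm_minus_cancel norm_one less_irrefl)
  have "((\<lambda>j. cnj (of_real (B gchoose j) * x ^ j)) has_sum cnj ((1 + x) powr of_real B)) UNIV"
    using binomial_has_sum[OF assms(1), of B] by (simp only: has_sum_cnj_iff)
  from has_sum_product_complex[OF binomial_has_sum[OF assms(1), of A] this]
  have "((\<lambda>(i, j). of_real ((A gchoose i) * (B gchoose j)) * (x ^ i * cnj x ^ j))
            has_sum ((1 + x) powr of_real A * cnj ((1 + x) powr of_real B))) UNIV"
    by (simp add: mult_ac)
  also have "(1 + x) powr of_real A * cnj ((1 + x) powr of_real B) = zpow (1 + x) A B"
    using \<open>1 + x \<noteq> 0\<close> assms(2) by (simp add: zpow_eq_exp powr_def exp_cnj mult_exp_exp)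
  finally show ?thesis .
qed

lemma binomial_times_has_sum:
  assumes bound: "\<And>r s. a r s \<noteq> 0 \<Longrightarrow> N \<le> r \<and> N \<le> s"
    and p: "p \<noteq> 0" "cmod p < 1" and "A - B \<in> \<int>" and \<epsilon>: "\<epsilon> = 1 \<or> \<epsilon> = - 1"
    and a: "((\<lambda>(r, s). a r s * zpow p r s) has_sum X) UNIV"
  shows "((\<lambda>(r, s). binomial_times \<epsilon> A B a r s * zpow p r s) has_sum (zpow (1 + \<epsilon> * p) A B * X)) UNIV"
proof -
  define t where "t r s i j = \<epsilon> ^ (i + j) * of_real ((A gchoose i) * (B gchoose j)) * a (r - real i) (s - real j)"
    for r s i j
  have "cnj \<epsilon> = \<epsilon>" "cmod (\<epsilon> * p) < 1"
    using \<epsilon> p by auto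
  have "((\<lambda>(u, v). (case u of (r, s) \<Rightarrow> a r s * zpow p r s) *
          (case v of (i, j) \<Rightarrow> of_real ((A gchoose i) * (B gchoose j)) * ((\<epsilon> * p) ^ i * cnj (\<epsilon> * p) ^ j)))
        has_sum (X * zpow (1 + \<epsilon> * p) A B)) (UNIV \<times> UNIV)"
    by (rule has_sum_product_complex[OF a zpow_binomial_has_sum[OF \<open>cmod (\<epsilon> * p) < 1\<close> \<open>A - B \<in> \<int>\<close>]])
  also have "?this \<longleftrightarrow> ((\<lambda>((r, s), (i, j)). t r s i j * zpow p r s) has_sum (zpow (1 + \<epsilon> * p) A B * X)) (UNIV \<times> UNIV)"
  proof (rule has_sum_reindex_bij_witness[where j = "\<lambda>((r, s), (i, j)). ((r + real i, s + real j), (i, j))"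
        and i = "\<lambda>((r, s), (i, j)). ((r - real i, s - real j), (i, j))"], goal_cases)
    case (5 x)
    obtain r s i j where x: "x = ((r, s), (i, j))"
      by (metis surj_pair)
    have "zpow p (r + real i) (s + real j) = zpow p r s * (p ^ i * cnj p ^ j)"
      using p(1) zpow_add[OF p(1), of "real i" "real j" r s] by (simp add: zpow_nat)
    then show ?case
      unfolding x t_def using \<open>cnj \<epsilon> = \<epsilon>\<close> by (simp add: power_mult_distrib power_add mult_ac)
  qed (auto simp: mult.commute)
  finally have sum: "((\<lambda>((r, s), (i, j)). t r s i j * zpow p r s) has_sum (zpow (1 + \<epsilon> * p) A B * X)) (UNIV \<times> UNIV)" .
  show ?thesis
  proof (rule has_sum_Sigma'[OF sum], goal_cases)
    case (1 u)
    obtain r s where u: "u = (r, s)"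
      by (metis surj_pair)
    have "real i \<le> r - N \<and> real j \<le> s - N" if "a (r - real i) (s - real j) \<noteq> 0" for i j
      using bound[OF that] by linarith
    then have "{(i, j). a (r - real i) (s - real j) \<noteq> 0} \<subseteq> {..nat \<lfloor>r - N\<rfloor>} \<times> {..nat \<lfloor>s - N\<rfloor>}"
      by (auto simp: le_nat_floor)
    then have "finite {(i, j). a (r - real i) (s - real j) \<noteq> 0}"
      by (rule finite_subset) auto
    then show ?case
      unfolding u by (intro has_sum_finite_neutralI[of "{(i, j). a (r - real i) (s - real j) \<noteq> 0}"])
        (auto simp: binomial_times_def t_def sum_distrib_right split_beta)
  qed
qed

lemma shift_has_sum:
  assumes "p \<noteq> 0" "\<alpha> - \<beta> \<in> \<int>" "((\<lambda>(r, s). b r s * zpow p r s) has_sum X) UNIV"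
  shows "((\<lambda>(r, s). b (r - \<alpha>) (s - \<beta>) * zpow p r s) has_sum (zpow p \<alpha> \<beta> * X)) UNIV"
proof -
  have "((\<lambda>(r, s). zpow p \<alpha> \<beta> * (b r s * zpow p r s)) has_sum (zpow p \<alpha> \<beta> * X)) UNIV"
    using has_sum_cmult_right[OF assms(3), of "zpow p \<alpha> \<beta>"] by (simp add: case_prod_unfold)
  also have "?this \<longleftrightarrow> ((\<lambda>(r, s). b (r - \<alpha>) (s - \<beta>) * zpow p r s) has_sum (zpow p \<alpha> \<beta> * X)) UNIV"
    using zpow_add[OF assms(1,2)]
    by (intro has_sum_reindex_bij_witness[where j = "\<lambda>(r, s). (r + \<alpha>, s + \<beta>)"
        and i = "\<lambda>(r, s). (r - \<alpha>, s - \<beta>)"]) auto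
  finally show ?thesis .
qed

text \<open>Uniqueness of the series is not needed: the chosen one converges to \<open>f\<close> because some series does.\<close>

lemma j_expansion_has_sum:
  assumes "a \<in> laurent2" "\<epsilon> > 0" "converges_abs_compactly a (\<lambda>q. f (\<psi> q)) (ball 0 \<epsilon> - {0})"
  shows "\<exists>N \<delta>. (\<forall>r s. j_expansion \<psi> f r s \<noteq> 0 \<longrightarrow> N \<le> r \<and> N \<le> s) \<and> \<delta> > 0 \<and>
    (\<forall>p. p \<noteq> 0 \<longrightarrow> cmod p < \<delta> \<longrightarrow>
       ((\<lambda>(r, s). j_expansion \<psi> f r s * zpow p r s) has_sum f (\<psi> p)) UNIV)"
proof -
  have "j_expansion \<psi> f \<in> laurent2 \<and>
        (\<exists>\<epsilon>>0. converges_abs_compactly (j_expansion \<psi> f) (\<lambda>q. f (\<psi> q)) (ball 0 \<epsilon> - {0}))"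
    unfolding j_expansion_def by (rule someI[of _ a]) (use assms in blast)
  then obtain \<delta> N where "\<delta> > 0" "\<forall>r s. j_expansion \<psi> f r s \<noteq> 0 \<longrightarrow> N \<le> r \<and> N \<le> s"
    "\<forall>p\<in>ball 0 \<delta> - {0}. ((\<lambda>(r, s). j_expansion \<psi> f r s * zpow p r s) has_sum f (\<psi> p)) UNIV"
    unfolding laurent2_def converges_abs_compactly_def by blast
  then show ?thesis
    by (intro exI[of _ N] exI[of _ \<delta>]) auto
qed

lemma F_0_1_inf_expansions:
  assumes "f \<in> F_0_1_inf" and \<psi>: "\<psi> = (\<lambda>q. q) \<or> \<psi> = (\<lambda>q. 1 / q) \<or> \<psi> = (\<lambda>q. 1 / (1 - q))"
  shows "\<exists>N \<delta>. (\<forall>r s. j_expansion \<psi> f r s \<noteq> 0 \<longrightarrow> N \<le> r \<and> N \<le> s) \<and> \<delta> > 0 \<and>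
    (\<forall>p. p \<noteq> 0 \<longrightarrow> cmod p < \<delta> \<longrightarrow>
       ((\<lambda>(r, s). j_expansion \<psi> f r s * zpow p r s) has_sum f (\<psi> p)) UNIV)"
proof -
  have id_chart: "holomorphic_chart 0 UNIV (\<lambda>q. q)"
    by (auto simp: holomorphic_chart_def)
  have inv_id: "inv_into UNIV (\<lambda>q::complex. q) = (\<lambda>q. q)"
    by (rule ext) (auto intro: inv_f_eq)
  \<comment> \<open>the identity is a chart at 0; it covers the coordinates \<open>p\<close> and \<open>1/p\<close>\<close>
  have at_0: "\<exists>a\<in>laurent2. \<exists>\<epsilon>>0. converges_abs_compactly a g (ball 0 \<epsilon> - {0})"
    if g: "conformal_singularity_at g 0" for g
  proof -
    obtain a \<epsilon> where "a \<in> laurent2" "\<epsilon> > 0"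
      "converges_abs_compactly a (\<lambda>p. g (inv_into UNIV (\<lambda>q. q) p)) (ball 0 \<epsilon> - {0})"
      using g id_chart unfolding conformal_singularity_at_def by blast
    then show ?thesis
      unfolding inv_id by blast
  qed
  have "\<exists>a\<in>laurent2. \<exists>\<epsilon>>0. converges_abs_compactly a (\<lambda>q. f (\<psi> q)) (ball 0 \<epsilon> - {0})"
    using \<psi>
  proof (elim disjE)
    assume "\<psi> = (\<lambda>q. q)"
    then show ?thesis
      using assms(1) at_0 by (simp add: F_0_1_inf_def)
  next
    assume "\<psi> = (\<lambda>q. 1 / q)"
    then show ?thesis
      using assms(1) at_0 by (simp add: F_0_1_inf_def)
  next
    assume \<psi>: "\<psi> = (\<lambda>q. 1 / (1 - q))"
    let ?\<kappa> = "\<lambda>q::complex. 1 - 1 / q"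
    have "holomorphic_chart 1 (- {0}) ?\<kappa>"
      unfolding holomorphic_chart_def by (auto intro!: holomorphic_intros simp: inj_on_def)
    then obtain a \<epsilon> where a: "a \<in> laurent2" "\<epsilon> > 0" "ball 0 \<epsilon> \<subseteq> ?\<kappa> ` (- {0})"
      "converges_abs_compactly a (\<lambda>p. f (inv_into (- {0}) ?\<kappa> p)) (ball 0 \<epsilon> - {0})"
      using assms(1) unfolding F_0_1_inf_def conformal_singularity_at_def by blast
    have "inv_into (- {0}) ?\<kappa> p = \<psi> p" if "p \<in> ball 0 \<epsilon>" for p
    proof (rule inv_into_f_eq)
      obtain q where "q \<noteq> 0" "p = 1 - 1 / q"
        using \<open>p \<in> ball 0 \<epsilon>\<close> a(3) by blast
      then have "p \<noteq> 1"
        by simp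
      then show "\<psi> p \<in> - {0}" "1 - 1 / \<psi> p = p"
        by (auto simp: \<psi>)
    qed (auto simp: inj_on_def)
    then have "converges_abs_compactly a (\<lambda>q. f (\<psi> q)) (ball 0 \<epsilon> - {0})"
      using a(4) unfolding converges_abs_compactly_def by auto
    then show ?thesis
      using a by blast
  qed
  then obtain a \<epsilon> where "a \<in> laurent2" "\<epsilon> > 0"
    "converges_abs_compactly a (\<lambda>q. f (\<psi> q)) (ball 0 \<epsilon> - {0})"
    by blast
  then show ?thesis
    by (rule j_expansion_has_sum)
qed

text \<open>The parts of total degree \<open>(R, S)\<close> of \<open>A\<close>, \<open>B\<close>, \<open>C\<close> are the expansions of the homogeneous function
  \<open>\<mu>(z\<^sub>1, z\<^sub>2)\<close> with \<open>\<mu>(1, w) = g w\<close> in the regions \<open>|z\<^sub>1| > |z\<^sub>2|\<close>, \<open>|z\<^sub>2| > |z\<^sub>1 - z\<^sub>2|\<close>, \<open>|z\<^sub>2| > |z\<^sub>1|\<close>.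
  The first one is read off at \<open>z\<^sub>1 = 1, z\<^sub>2 = p\<close>, the other two at \<open>z\<^sub>2 = 1\<close> and
  \<open>z\<^sub>1 = 1 + p\<close>, respectively \<open>z\<^sub>1 = p\<close>, where \<open>\<mu>(z\<^sub>1, 1) = z\<^sub>1\<^sup>R zbar\<^sub>1\<^sup>S g(1/z\<^sub>1)\<close>.\<close>

definition expansions_of ::
    "real \<Rightarrow> real \<Rightarrow> (complex \<Rightarrow> complex) \<Rightarrow> series4 \<Rightarrow> series4 \<Rightarrow> series4 \<Rightarrow> bool" where
  "expansions_of R S g A B C \<longleftrightarrow>
     (\<forall>w. w \<noteq> 0 \<longrightarrow> w \<noteq> 1 \<longrightarrow> line_analytic_at g w) \<and>
     (\<forall>\<^sub>F p in at 0.
        ((\<lambda>(r, s). A (R - r) (S - s) r s * zpow p r s) has_sum g p) UNIV \<and>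
        ((\<lambda>(r, s). B r s (R - r) (S - s) * zpow p r s) has_sum (zpow (1 + p) R S * g (1 / (1 + p)))) UNIV \<and>
        ((\<lambda>(r, s). C r s (R - r) (S - s) * zpow p r s) has_sum (zpow p R S * g (1 / p))) UNIV)"

lemma expansions_of_gen:
  assumes "\<alpha>1 - \<beta>1 \<in> \<int>" "\<alpha>2 - \<beta>2 \<in> \<int>" "\<alpha>12 - \<beta>12 \<in> \<int>" and f: "f \<in> F_0_1_inf"
    and R: "R = \<alpha>1 + \<alpha>2 + \<alpha>12" and S: "S = \<beta>1 + \<beta>2 + \<beta>12"
  shows "expansions_of R S (\<lambda>w. zpow w \<alpha>2 \<beta>2 * (zpow (1 - w) \<alpha>12 \<beta>12 * f w))
       (expand_1_2 \<alpha>1 \<alpha>2 \<alpha>12 \<beta>1 \<beta>2 \<beta>12 f)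
       (expand_2_12 \<alpha>1 \<alpha>2 \<alpha>12 \<beta>1 \<beta>2 \<beta>12 f)
       (expand_2_1 \<alpha>1 \<alpha>2 \<alpha>12 \<beta>1 \<beta>2 \<beta>12 f)"
  (is "expansions_of _ _ ?g _ _ _")
proof -
  have "line_analytic_at ?g w" if "w \<noteq> 0" "w \<noteq> 1" for w
  proof (intro line_analytic_at_mult line_analytic_at_zpow)
    have "line_analytic_at (\<lambda>z. zpow z \<alpha>12 \<beta>12) (1 + (- 1) * w)"
      using that assms(3) by (intro line_analytic_at_zpow) auto
    from line_analytic_at_affine[OF this] show "line_analytic_at (\<lambda>w. zpow (1 - w) \<alpha>12 \<beta>12) w"
      by simp
    show "line_analytic_at f w"
      using f that by (auto simp: F_0_1_inf_def intro: real_analytic_imp_line_analytic)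
  qed (use that assms(2) in auto)
  moreover
  obtain N1 \<delta>1 where j1: "\<And>r s. j_expansion (\<lambda>q. q) f r s \<noteq> 0 \<Longrightarrow> N1 \<le> r \<and> N1 \<le> s" "\<delta>1 > 0"
    "\<And>p. p \<noteq> 0 \<Longrightarrow> cmod p < \<delta>1 \<Longrightarrow>
       ((\<lambda>(r, s). j_expansion (\<lambda>q. q) f r s * zpow p r s) has_sum f p) UNIV"
    using F_0_1_inf_expansions[OF f, of "\<lambda>q. q"] by blast
  obtain N2 \<delta>2 where j2: "\<And>r s. j_expansion (\<lambda>q. 1 / q) f r s \<noteq> 0 \<Longrightarrow> N2 \<le> r \<and> N2 \<le> s" "\<delta>2 > 0"
    "\<And>p. p \<noteq> 0 \<Longrightarrow> cmod p < \<delta>2 \<Longrightarrow>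
       ((\<lambda>(r, s). j_expansion (\<lambda>q. 1 / q) f r s * zpow p r s) has_sum f (1 / p)) UNIV"
    using F_0_1_inf_expansions[OF f, of "\<lambda>q. 1 / q"] by blast
  obtain N3 \<delta>3 where j3: "\<And>r s. j_expansion (\<lambda>q. 1 / (1 - q)) f r s \<noteq> 0 \<Longrightarrow> N3 \<le> r \<and> N3 \<le> s" "\<delta>3 > 0"
    "\<And>p. p \<noteq> 0 \<Longrightarrow> cmod p < \<delta>3 \<Longrightarrow>
       ((\<lambda>(r, s). j_expansion (\<lambda>q. 1 / (1 - q)) f r s * zpow p r s) has_sum f (1 / (1 - p))) UNIV"
    using F_0_1_inf_expansions[OF f, of "\<lambda>q. 1 / (1 - q)"] by blast
  define \<delta> where "\<delta> = min (min \<delta>1 \<delta>2) (min \<delta>3 1)"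
  have "((\<lambda>(r, s). expand_1_2 \<alpha>1 \<alpha>2 \<alpha>12 \<beta>1 \<beta>2 \<beta>12 f (R - r) (S - s) r s * zpow p r s) has_sum ?g p) UNIV"
    if p: "p \<noteq> 0" "cmod p < \<delta>" for p
    using shift_has_sum[OF p(1) assms(2) binomial_times_has_sum[OF j1(1) p(1) _ assms(3) _ j1(3)[OF p(1)], where \<epsilon> = "- 1"]] p
    by (simp add: expand_1_2_def R S \<delta>_def)
  moreover
  have cancel: "x * (y * (inverse x * inverse y)) = 1" if "x \<noteq> 0" "y \<noteq> 0" for x y :: complex
    using that by (simp add: field_simps)
  have "((\<lambda>(r, s). expand_2_12 \<alpha>1 \<alpha>2 \<alpha>12 \<beta>1 \<beta>2 \<beta>12 f r s (R - r) (S - s) * zpow p r s)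
      has_sum (zpow (1 + p) R S * ?g (1 / (1 + p)))) UNIV"
    if p: "p \<noteq> 0" "cmod p < \<delta>" for p
  proof -
    let ?j = "\<lambda>r s. parity_sign (r - s) * j_expansion (\<lambda>q. 1 / (1 - q)) f r s"
    have "((\<lambda>(r, s). ?j r s * zpow p r s) has_sum f (1 / (1 + p))) UNIV"
      using j3(3)[of "- p"] p by (simp add: zpow_minus_one \<delta>_def mult_ac)
    moreover have "N3 \<le> r \<and> N3 \<le> s" if "?j r s \<noteq> 0" for r s
      using that by (intro j3(1)) auto
    ultimately have "((\<lambda>(r, s). binomial_times 1 \<alpha>1 \<beta>1 ?j (r - \<alpha>12) (s - \<beta>12) * zpow p r s) has_sum
        (zpow p \<alpha>12 \<beta>12 * (zpow (1 + 1 * p) \<alpha>1 \<beta>1 * f (1 / (1 + p))))) UNIV"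
      using p by (intro shift_has_sum[OF p(1) assms(3)] binomial_times_has_sum[OF _ p(1) _ assms(1)])
        (auto simp: \<delta>_def)
    moreover have "zpow p \<alpha>12 \<beta>12 * (zpow (1 + 1 * p) \<alpha>1 \<beta>1 * f (1 / (1 + p))) =
        zpow (1 + p) R S * ?g (1 / (1 + p))"
    proof -
      have nz: "1 + p \<noteq> 0"
        using p by (auto simp: \<delta>_def add_eq_0_iff)
      have "1 - 1 / (1 + p) = p * (1 / (1 + p))"
        using nz by (simp add: field_simps)
      then have "zpow (1 - 1 / (1 + p)) \<alpha>12 \<beta>12 = zpow p \<alpha>12 \<beta>12 * zpow (1 / (1 + p)) \<alpha>12 \<beta>12"
        by (simp only: zpow_mult)
      moreover have "zpow (1 + p) R S = zpow (1 + p) \<alpha>1 \<beta>1 * zpow (1 + p) \<alpha>2 \<beta>2 * zpow (1 + p) \<alpha>12 \<beta>12"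
        unfolding R S using nz assms(2,3) by (simp add: zpow_add)
      moreover have "zpow (1 / (1 + p)) A B = inverse (zpow (1 + p) A B)" for A B
        using zpow_inverse[of "1 + p" A B] by (simp add: inverse_eq_divide)
      ultimately show ?thesis
        using cancel zpow_nonzero[OF nz] by simp
    qed
    moreover have "expand_2_12 \<alpha>1 \<alpha>2 \<alpha>12 \<beta>1 \<beta>2 \<beta>12 f r s (R - r) (S - s) =
        binomial_times 1 \<alpha>1 \<beta>1 ?j (r - \<alpha>12) (s - \<beta>12)" for r s
      by (simp add: expand_2_12_def R S)
    ultimately show ?thesis
      by (simp only:)
  qed
  moreover
  have "((\<lambda>(r, s). expand_2_1 \<alpha>1 \<alpha>2 \<alpha>12 \<beta>1 \<beta>2 \<beta>12 f r s (R - r) (S - s) * zpow p r s)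
      has_sum (zpow p R S * ?g (1 / p))) UNIV"
    if p: "p \<noteq> 0" "cmod p < \<delta>" for p
  proof -
    have "((\<lambda>(r, s). binomial_times (- 1) \<alpha>12 \<beta>12 (j_expansion (\<lambda>q. 1 / q) f) (r - \<alpha>1) (s - \<beta>1) * zpow p r s)
       has_sum (zpow p \<alpha>1 \<beta>1 * (zpow (1 - p) \<alpha>12 \<beta>12 * f (1 / p)))) UNIV"
      using shift_has_sum[OF p(1) assms(1) binomial_times_has_sum[OF j2(1) p(1) _ assms(3) _ j2(3)[OF p(1)], where \<epsilon> = "- 1"]] p
      by (simp add: \<delta>_def)
    from has_sum_cmult_right[OF this, of "parity_sign (\<alpha>12 - \<beta>12)"]
    have "((\<lambda>(r, s). parity_sign (\<alpha>12 - \<beta>12) *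
          binomial_times (- 1) \<alpha>12 \<beta>12 (j_expansion (\<lambda>q. 1 / q) f) (r - \<alpha>1) (s - \<beta>1) * zpow p r s)
      has_sum (parity_sign (\<alpha>12 - \<beta>12) * (zpow p \<alpha>1 \<beta>1 * (zpow (1 - p) \<alpha>12 \<beta>12 * f (1 / p))))) UNIV"
      by (simp only: case_prod_unfold mult.assoc)
    moreover have "expand_2_1 \<alpha>1 \<alpha>2 \<alpha>12 \<beta>1 \<beta>2 \<beta>12 f r s (R - r) (S - s) = parity_sign (\<alpha>12 - \<beta>12) *
          binomial_times (- 1) \<alpha>12 \<beta>12 (j_expansion (\<lambda>q. 1 / q) f) (r - \<alpha>1) (s - \<beta>1)" for r s
      by (simp add: expand_2_1_def R S)
    moreover have "parity_sign (\<alpha>12 - \<beta>12) * (zpow p \<alpha>1 \<beta>1 * (zpow (1 - p) \<alpha>12 \<beta>12 * f (1 / p))) =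
      zpow p R S * ?g (1 / p)"
    proof -
      have "1 - 1 / p = - ((1 - p) * (1 / p))"
        using p(1) by (simp add: field_simps)
      then have "zpow (1 - 1 / p) \<alpha>12 \<beta>12 =
          parity_sign (\<alpha>12 - \<beta>12) * (zpow (1 - p) \<alpha>12 \<beta>12 * zpow (1 / p) \<alpha>12 \<beta>12)"
        by (simp only: zpow_minus_one zpow_mult)
      moreover have "zpow p R S = zpow p \<alpha>1 \<beta>1 * zpow p \<alpha>2 \<beta>2 * zpow p \<alpha>12 \<beta>12"
        unfolding R S using p(1) assms(2,3) by (simp add: zpow_add)
      moreover have "zpow (1 / p) A B = inverse (zpow p A B)" for A B
        using zpow_inverse[of p A B] by (simp add: inverse_eq_divide)
      ultimately show ?thesis
        using cancel zpow_nonzero[OF p(1)] by simp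
    qed
    ultimately show ?thesis
      by (simp only:)
  qed
  moreover have "\<delta> > 0"
    using j1(2) j2(2) j3(2) by (simp add: \<delta>_def)
  ultimately show ?thesis
    unfolding expansions_of_def eventually_at dist_0_norm norm_conv_dist[symmetric] by blast
qed

lemma expansions_of_zero: "expansions_of R S (\<lambda>_. 0) (\<lambda>_ _ _ _. 0) (\<lambda>_ _ _ _. 0) (\<lambda>_ _ _ _. 0)"
  by (simp add: expansions_of_def line_analytic_at_const has_sum_0)

lemma expansions_of_add:
  assumes g: "expansions_of R S g A B C" and g': "expansions_of R S g' A' B' C'"
  shows "expansions_of R S (\<lambda>w. g w + g' w)
       (\<lambda>r s t u. A r s t u + A' r s t u)
       (\<lambda>r s t u. B r s t u + B' r s t u)
       (\<lambda>r s t u. C r s t u + C' r s t u)"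
proof -
  have add: "((\<lambda>(r, s). (u r s + v r s) * zpow p r s) has_sum (x + y)) UNIV"
    if "((\<lambda>(r, s). u r s * zpow p r s) has_sum x) UNIV"
       "((\<lambda>(r, s). v r s * zpow p r s) has_sum y) UNIV" for u v p x y
    using has_sum_add[OF that] by (simp add: case_prod_unfold distrib_right)
  show ?thesis
    unfolding expansions_of_def distrib_left
  proof (intro conjI allI impI line_analytic_at_add)
    show "\<forall>\<^sub>F p in at 0.
        ((\<lambda>(r, s). (A (R - r) (S - s) r s + A' (R - r) (S - s) r s) * zpow p r s) has_sum g p + g' p) UNIV \<and>
        ((\<lambda>(r, s). (B r s (R - r) (S - s) + B' r s (R - r) (S - s)) * zpow p r s)
            has_sum zpow (1 + p) R S * g (1 / (1 + p)) + zpow (1 + p) R S * g' (1 / (1 + p))) UNIV \<and>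
        ((\<lambda>(r, s). (C r s (R - r) (S - s) + C' r s (R - r) (S - s)) * zpow p r s)
            has_sum zpow p R S * g (1 / p) + zpow p R S * g' (1 / p)) UNIV"
      using conjunct2[OF g[unfolded expansions_of_def]] conjunct2[OF g'[unfolded expansions_of_def]]
      by eventually_elim (intro conjI add; elim conjE; assumption)
  qed (use g g' in \<open>simp_all add: expansions_of_def\<close>)
qed

lemma expansions_of_scale:
  assumes g: "expansions_of R S g A B C"
  shows "expansions_of R S (\<lambda>w. k * g w)
       (\<lambda>r s t u. k * A r s t u) (\<lambda>r s t u. k * B r s t u) (\<lambda>r s t u. k * C r s t u)"
proof -
  have scale: "((\<lambda>(r, s). k * u r s * zpow p r s) has_sum (k * x)) UNIV"
    if "((\<lambda>(r, s). u r s * zpow p r s) has_sum x) UNIV" for u p x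
    using has_sum_cmult_right[OF that, of k] by (simp add: case_prod_unfold mult.assoc)
  show ?thesis
    unfolding expansions_of_def mult.left_commute[of _ k]
  proof (intro conjI allI impI line_analytic_at_mult line_analytic_at_const)
    show "\<forall>\<^sub>F p in at 0.
        ((\<lambda>(r, s). k * A (R - r) (S - s) r s * zpow p r s) has_sum k * g p) UNIV \<and>
        ((\<lambda>(r, s). k * B r s (R - r) (S - s) * zpow p r s) has_sum k * (zpow (1 + p) R S * g (1 / (1 + p)))) UNIV \<and>
        ((\<lambda>(r, s). k * C r s (R - r) (S - s) * zpow p r s) has_sum k * (zpow p R S * g (1 / p))) UNIV"
      using conjunct2[OF g[unfolded expansions_of_def]]
      by eventually_elim (intro conjI scale; elim conjE; assumption)
  qed (use g in \<open>simp add: expansions_of_def\<close>)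
qed

lemma GCor2_expansions:
  assumes "GCor2 \<mu> A B C"
  shows "\<exists>g. expansions_of R S g A B C"
  using assms
proof induction
  case (GCor2_gen \<alpha>1 \<beta>1 \<alpha>2 \<beta>2 \<alpha>12 \<beta>12 f)
  show ?case
  proof (cases "R = \<alpha>1 + \<alpha>2 + \<alpha>12 \<and> S = \<beta>1 + \<beta>2 + \<beta>12")
    case True
    then show ?thesis
      using expansions_of_gen[OF GCor2_gen, of R S] by (intro exI) simp
  next
    \<comment> \<open>a generator of another degree does not contribute\<close>
    case False
    then have "expand_1_2 \<alpha>1 \<alpha>2 \<alpha>12 \<beta>1 \<beta>2 \<beta>12 f (R - r) (S - s) r s = 0"
      "expand_2_12 \<alpha>1 \<alpha>2 \<alpha>12 \<beta>1 \<beta>2 \<beta>12 f r s (R - r) (S - s) = 0"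
      "expand_2_1 \<alpha>1 \<alpha>2 \<alpha>12 \<beta>1 \<beta>2 \<beta>12 f r s (R - r) (S - s) = 0" for r s
      by (auto simp: expand_1_2_def expand_2_12_def expand_2_1_def)
    then have "expansions_of R S (\<lambda>_. 0) (expand_1_2 \<alpha>1 \<alpha>2 \<alpha>12 \<beta>1 \<beta>2 \<beta>12 f)
       (expand_2_12 \<alpha>1 \<alpha>2 \<alpha>12 \<beta>1 \<beta>2 \<beta>12 f) (expand_2_1 \<alpha>1 \<alpha>2 \<alpha>12 \<beta>1 \<beta>2 \<beta>12 f)"
      by (simp add: expansions_of_def line_analytic_at_const has_sum_0)
    then show ?thesis
      by (rule exI[of _ "\<lambda>_. 0"])
  qed
next
  case GCor2_zero
  then show ?case
    by (intro exI) (rule expansions_of_zero)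
next
  case (GCor2_add \<mu> A B C \<mu>' A' B' C')
  then obtain g g' where "expansions_of R S g A B C" "expansions_of R S g' A' B' C'"
    by blast
  then show ?case
    by (intro exI) (rule expansions_of_add)
next
  case (GCor2_scale \<mu> A B C k)
  then obtain g where "expansions_of R S g A B C"
    by blast
  then show ?case
    by (intro exI) (rule expansions_of_scale)
qed

section \<open>Two-point functions whose first expansion is a monomial\<close>

lemma real_powser_zero_coeffs:
  fixes a :: "nat \<Rightarrow> real"
  assumes "\<delta> > 0" and sums: "\<And>t. t \<noteq> 0 \<Longrightarrow> \<bar>t\<bar> < \<delta> \<Longrightarrow> (\<lambda>k. a k * t ^ k) sums 0"
  shows "a k = 0"
  using sums
proof (induction k arbitrary: a)
  have zero: "a 0 = 0" if "\<And>t. t \<noteq> 0 \<Longrightarrow> \<bar>t\<bar> < \<delta> \<Longrightarrow> (\<lambda>k. a k * t ^ k) sums 0" for a :: "nat \<Rightarrow> real"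
  proof -
    have "((\<lambda>_. 0) \<longlongrightarrow> a 0) (at (0::real))"
      by (rule powser_limit_0_strong[OF \<open>\<delta> > 0\<close>]) (use that in auto)
    then show ?thesis
      by (metis LIM_const_eq)
  qed
  {
    case 0
    then show ?case
      by (rule zero)
  next
    case (Suc k)
    have "(\<lambda>n. a (Suc n) * t ^ n) sums 0" if "t \<noteq> 0" "\<bar>t\<bar> < \<delta>" for t
    proof -
      have "(\<lambda>n. a (Suc n) * t ^ Suc n) sums 0"
        using Suc.prems[OF that] zero[OF Suc.prems] sums_Suc_iff[of "\<lambda>k. a k * t ^ k" 0] by simp
      then have "(\<lambda>n. a (Suc n) * t ^ Suc n / t) sums (0 / t)"
        by (rule sums_divide)
      then show ?thesis
        using that(1) by simp
    qed
    then show ?case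
      by (rule Suc.IH)
  }
qed

text \<open>Along \<open>p = t e\<close> with \<open>|e| = 1\<close> the linear term is \<open>d\<^sub>0\<^sub>1 cnj e + d\<^sub>1\<^sub>0 e\<close>; the directions \<open>e = 1\<close> and \<open>e = \<i>\<close>
  separate the two coefficients.\<close>

lemma double_powser_linear_coeffs:
  assumes "\<delta> > 0"
    and sum: "\<And>p. p \<noteq> 0 \<Longrightarrow> cmod p < \<delta> \<Longrightarrow>
      ((\<lambda>(i, j). d i j * (p ^ i * cnj p ^ j)) has_sum 0) UNIV"
  shows "d 0 1 = 0" "d 1 0 = 0"
proof -
  have linear: "d 0 1 * cnj e + d 1 0 * e = 0" if "cmod e = 1" for e
  proof -
    have "e \<noteq> 0"
      using that by auto
    define c where "c k = (\<Sum>i\<le>k. d i (k - i) * (e ^ i * cnj e ^ (k - i)))" for k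
    have "(\<lambda>k. c k * of_real t ^ k) sums 0" if "t \<noteq> 0" "\<bar>t\<bar> < \<delta>" for t :: real
      using has_sum_antidiagonal[of "\<lambda>i j. d i j * (e ^ i * cnj e ^ j)" "of_real t" 0]
        sum[of "of_real t * e"] that \<open>cmod e = 1\<close> \<open>e \<noteq> 0\<close>
      by (simp add: c_def norm_mult power_mult_distrib power_add mult_ac)
    then have "(\<lambda>k. Re (c k) * t ^ k) sums 0" "(\<lambda>k. Im (c k) * t ^ k) sums 0"
      if "t \<noteq> 0" "\<bar>t\<bar> < \<delta>" for t :: real
      using that by (auto simp: sums_complex_iff simp flip: of_real_power)
    then have "Re (c 1) = 0" "Im (c 1) = 0"
      using real_powser_zero_coeffs[OF \<open>\<delta> > 0\<close>, of "\<lambda>k. Re (c k)" 1]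
        real_powser_zero_coeffs[OF \<open>\<delta> > 0\<close>, of "\<lambda>k. Im (c k)" 1] by blast+
    then have "c 1 = 0"
      by (simp add: complex_eq_iff)
    then show ?thesis
      by (simp add: c_def)
  qed
  have "d 0 1 + d 1 0 = 0" "- d 0 1 + d 1 0 = 0"
    using linear[of 1] linear[of \<i>] by (simp_all add: algebra_simps)
  then show "d 0 1 = 0" "d 1 0 = 0"
    by (auto simp: add_eq_0_iff)
qed

lemma has_sum_single_complex:
  assumes "((\<lambda>(r, s). a r s * zpow p r s) has_sum x) UNIV"
    and "\<And>r s. a r s \<noteq> 0 \<Longrightarrow> r = r0 \<and> s = s0"
  shows "x = a r0 s0 * zpow p r0 s0"
proof -
  have "((\<lambda>(r, s). a r s * zpow p r s) has_sum (a r0 s0 * zpow p r0 s0)) UNIV"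
    by (rule has_sum_finite_neutralI[of "{(r0, s0)}"]) (use assms(2) in force)+
  then show ?thesis
    using assms(1) has_sum_unique by blast
qed

lemma expansions_of_monomial:
  assumes g: "expansions_of R S g A B C" and "q \<in> \<int>"
    and A: "\<And>r s. A (R - r) (S - s) r s \<noteq> 0 \<Longrightarrow> r = 0 \<and> s = q"
    and w: "w \<noteq> 0" "w \<noteq> 1"
  shows "g w = A R (S - q) 0 q * zpow w 0 q"
proof -
  let ?h = "\<lambda>w. g w + (- A R (S - q) 0 q) * zpow w 0 q"
  have "\<forall>\<^sub>F p in at 0. ((\<lambda>(r, s). A (R - r) (S - s) r s * zpow p r s) has_sum g p) UNIV"
    using g unfolding expansions_of_def by (blast intro: eventually_mono)
  then obtain \<delta> where \<delta>: "\<delta> > 0" "\<And>p. p \<noteq> 0 \<Longrightarrow> cmod p < \<delta> \<Longrightarrow>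
      ((\<lambda>(r, s). A (R - r) (S - s) r s * zpow p r s) has_sum g p) UNIV"
    unfolding eventually_at by (auto simp: dist_norm)
  have "?h w = 0"
  proof (rule line_analytic_zero[OF _ \<delta>(1) _ w])
    fix w :: complex assume "w \<noteq> 0" "w \<noteq> 1"
    then show "line_analytic_at ?h w"
      using g \<open>q \<in> \<int>\<close> unfolding expansions_of_def
      by (intro line_analytic_at_add line_analytic_at_mult line_analytic_at_const line_analytic_at_zpow) auto
  next
    fix p :: complex assume "p \<noteq> 0" "cmod p < \<delta>"
    from has_sum_single_complex[OF \<delta>(2)[OF this] A] show "?h p = 0"
      by simp
  qed
  then show ?thesis
    by simp
qed

lemma GCor2_commute:
  assumes "GCor2 \<mu> A B C" "S \<in> \<int>"
    and A: "\<And>r1 s1 r2 s2. A r1 s1 r2 s2 \<noteq> 0 \<Longrightarrow> s1 = 0 \<and> r2 = 0"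
    and C: "\<And>r1 s1 r2 s2. C r1 s1 r2 s2 \<noteq> 0 \<Longrightarrow> s1 = 0 \<and> r2 = 0"
  shows "A R 0 0 S = C R 0 0 S"
proof -
  obtain g where g: "expansions_of R S g A B C"
    using GCor2_expansions[OF assms(1)] by blast
  have g_eq: "g w = A R 0 0 S * zpow w 0 S" if "w \<noteq> 0" "w \<noteq> 1" for w
    using expansions_of_monomial[OF g \<open>S \<in> \<int>\<close> _ that] A by fastforce
  have "\<forall>\<^sub>F p in at 0. p \<noteq> 0 \<and> p \<noteq> 1 \<and>
      ((\<lambda>(r, s). C r s (R - r) (S - s) * zpow p r s) has_sum (zpow p R S * g (1 / p))) UNIV"
    using conjunct2[OF g[unfolded expansions_of_def]] eventually_neq_at_within[of 0 0 UNIV]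
      eventually_neq_at_within[of 1 0 UNIV]
    by eventually_elim blast
  then obtain p where p: "p \<noteq> 0" "p \<noteq> 1"
      "((\<lambda>(r, s). C r s (R - r) (S - s) * zpow p r s) has_sum (zpow p R S * g (1 / p))) UNIV"
    using eventually_happens'[OF at_neq_bot] by blast
  have lhs: "zpow p R S * g (1 / p) = C R 0 0 S * zpow p R 0"
    using has_sum_single_complex[OF p(3), of R 0] C by fastforce
  have split: "zpow p R S = zpow p R 0 * zpow p 0 S"
    using zpow_add[OF p(1), of 0 S R 0] \<open>S \<in> \<int>\<close> by simp
  have inverse: "zpow p 0 S * zpow (1 / p) 0 S = 1"
    using p(1) by (simp add: zpow_one flip: zpow_mult)
  have g_inverse: "g (1 / p) = A R 0 0 S * zpow (1 / p) 0 S"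
    using p by (intro g_eq) auto
  have "C R 0 0 S * zpow p R 0 = (zpow p R 0 * zpow p 0 S) * (A R 0 0 S * zpow (1 / p) 0 S)"
    by (rule lhs[symmetric, unfolded split g_inverse])
  also have "\<dots> = A R 0 0 S * zpow p R 0 * (zpow p 0 S * zpow (1 / p) 0 S)"
    by (simp only: mult_ac)
  also have "\<dots> = A R 0 0 S * zpow p R 0"
    by (simp add: inverse)
  finally have "C R 0 0 S * zpow p R 0 = A R 0 0 S * zpow p R 0" .
  then show ?thesis
    using zpow_nonzero[OF p(1)] by simp
qed

text \<open>By the hypothesis on \<open>A\<close> the function \<open>g\<close> is constant. Since \<open>B\<close> lives on natural exponents, it can be compared
  as an ordinary power series with the binomial expansion of \<open>(1 + p)\<^sup>R (1 + cnj p)\<^sup>S\<close>; only the linear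
  coefficients are recorded.\<close>

lemma GCor2_translation:
  assumes "GCor2 \<mu> A B C" and RS: "R - S \<in> \<int>"
    and A: "\<And>r1 s1 r2 s2. A r1 s1 r2 s2 \<noteq> 0 \<Longrightarrow> r2 = 0 \<and> s2 = 0"
    and B: "\<And>r0 s0 r2 s2. B r0 s0 r2 s2 \<noteq> 0 \<Longrightarrow> r0 \<in> \<nat> \<and> s0 \<in> \<nat>"
  shows "B 0 1 R (S - 1) = of_real S * A R S 0 0" "B 1 0 (R - 1) S = of_real R * A R S 0 0"
proof -
  obtain g where g: "expansions_of R S g A B C"
    using GCor2_expansions[OF assms(1)] by blast
  have g_eq: "g w = A R S 0 0" if "w \<noteq> 0" "w \<noteq> 1" for w
    using expansions_of_monomial[OF g, of 0 w] A that by (simp add: zpow_0_0)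
  have "\<forall>\<^sub>F p in at 0.
      ((\<lambda>(r, s). B r s (R - r) (S - s) * zpow p r s) has_sum (zpow (1 + p) R S * g (1 / (1 + p)))) UNIV"
    using g unfolding expansions_of_def by (blast intro: eventually_mono)
  then obtain \<delta> where \<delta>: "\<delta> > 0" "\<And>p. p \<noteq> 0 \<Longrightarrow> cmod p < \<delta> \<Longrightarrow>
      ((\<lambda>(r, s). B r s (R - r) (S - s) * zpow p r s) has_sum (zpow (1 + p) R S * g (1 / (1 + p)))) UNIV"
    unfolding eventually_at by (auto simp: dist_norm)
  \<comment> \<open>the difference of the given expansion and the binomial expansion of the same function\<close>
  define d where "d i j = B (real i) (real j) (R - real i) (S - real j)
      - of_real ((R gchoose i) * (S gchoose j)) * A R S 0 0" for i j
  have "((\<lambda>(i, j). d i j * (p ^ i * cnj p ^ j)) has_sum 0) UNIV"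
    if p: "p \<noteq> 0" "cmod p < min \<delta> 1" for p
  proof -
    let ?X = "zpow (1 + p) R S * A R S 0 0"
    have "1 + p \<noteq> 0"
      using p(2) by (auto simp: add_eq_0_iff)
    then have "g (1 / (1 + p)) = A R S 0 0"
      using p(1) by (intro g_eq) auto
    then have "((\<lambda>(r, s). B r s (R - r) (S - s) * zpow p r s) has_sum ?X) UNIV"
      using \<delta>(2)[OF p(1)] p(2) by simp
    also have "?this \<longleftrightarrow> ((\<lambda>(r, s). B r s (R - r) (S - s) * zpow p r s) has_sum ?X)
        ((\<lambda>(i, j). (real i, real j)) ` UNIV)"
    proof (rule has_sum_cong_neutral)
      fix x :: "real \<times> real" assume x: "x \<in> UNIV - (\<lambda>(i, j). (real i, real j)) ` UNIV"
      obtain r s where rs: "x = (r, s)"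
        by fastforce
      have "B r s (R - r) (S - s) = 0"
      proof (rule ccontr)
        assume "B r s (R - r) (S - s) \<noteq> 0"
        then obtain i j where "r = real i" "s = real j"
          using B by (meson Nats_cases)
        then show False
          using x rs by (auto simp: image_iff)
      qed
      then show "(case x of (r, s) \<Rightarrow> B r s (R - r) (S - s) * zpow p r s) = 0"
        using rs by simp
    qed auto
    also have "\<dots> \<longleftrightarrow> ((\<lambda>(i, j). B (real i) (real j) (R - real i) (S - real j) * (p ^ i * cnj p ^ j)) has_sum ?X) UNIV"
      by (subst has_sum_reindex) (auto simp: inj_on_def o_def case_prod_unfold zpow_nat[OF p(1)])
    finally have B_sum: "((\<lambda>(i, j). B (real i) (real j) (R - real i) (S - real j) * (p ^ i * cnj p ^ j)) has_sum ?X) UNIV" .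
    have "((\<lambda>(i, j). of_real ((R gchoose i) * (S gchoose j)) * A R S 0 0 * (p ^ i * cnj p ^ j)) has_sum ?X) UNIV"
      using has_sum_cmult_left[OF zpow_binomial_has_sum[OF _ RS], of p "A R S 0 0"] p(2)
      by (simp add: case_prod_unfold mult_ac)
    from has_sum_add[OF B_sum has_sum_uminusI[OF this]] show ?thesis
      by (simp add: d_def case_prod_unfold left_diff_distrib)
  qed
  then have "d 0 1 = 0" "d 1 0 = 0"
    using double_powser_linear_coeffs[of "min \<delta> 1" d] \<delta>(1) by simp_all
  then show "B 0 1 R (S - 1) = of_real S * A R S 0 0" "B 1 0 (R - 1) S = of_real R * A R S 0 0"
    by (simp_all add: d_def)
qed

section \<open>Highest weight arguments for two commuting conformal symmetries\<close>

text \<open>A graded representation of \<open>sl\<^sub>2\<close> by a raising operator \<open>e\<close> and a lowering operator \<open>f\<close>, with \<open>f e - e f = 2 h\<close>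
  in weight \<open>h\<close>. Nothing is assumed outside of the weight spaces \<open>K h\<close>.\<close>

locale sl2_action = vector_space smul
  for smul :: "complex \<Rightarrow> 'v::ab_group_add \<Rightarrow> 'v" +
  fixes K :: "real \<Rightarrow> 'v set" and e f :: "'v \<Rightarrow> 'v"
  assumes subspace_K: "subspace (K h)"
    and linear_e: "Vector_Spaces.linear smul smul e"
    and linear_f: "Vector_Spaces.linear smul smul f"
    and e_degree: "v \<in> K h \<Longrightarrow> e v \<in> K (h + 1)"
    and f_degree: "v \<in> K h \<Longrightarrow> f v \<in> K (h - 1)"
    and commutator: "v \<in> K h \<Longrightarrow> f (e v) - e (f v) = smul (of_real (2 * h)) v"
begin

sublocale e: Vector_Spaces.linear smul smul e
  by (rule linear_e)

sublocale f: Vector_Spaces.linear smul smul f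
  by (rule linear_f)

lemma e_power_degree: "v \<in> K h \<Longrightarrow> (e ^^ n) v \<in> K (h + real n)"
proof (induction n)
  case (Suc n)
  then have "e ((e ^^ n) v) \<in> K (h + real n + 1)"
    by (intro e_degree) simp
  then show ?case
    by (simp add: add_ac)
qed simp

lemma e_power_zero: "(e ^^ n) 0 = 0"
  by (induction n) (simp_all add: e.zero)

lemma lower_raise:
  assumes "v \<in> K h" "f v = 0"
  shows "f ((e ^^ Suc n) v) = smul (of_real ((real n + 1) * (2 * h + real n))) ((e ^^ n) v)"
proof (induction n)
  case 0
  show ?case
    using commutator[OF assms(1)] assms(2) by simp
next
  case (Suc n)
  have "f (e ((e ^^ Suc n) v)) = e (f ((e ^^ Suc n) v)) + smul (of_real (2 * (h + real (Suc n)))) ((e ^^ Suc n) v)"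
    using commutator[OF e_power_degree[OF assms(1)], of "Suc n"] by (simp add: algebra_simps)
  also have "e (f ((e ^^ Suc n) v)) = smul (of_real ((real n + 1) * (2 * h + real n))) ((e ^^ Suc n) v)"
    by (simp only: Suc.IH e.scale) simp
  finally have "f ((e ^^ Suc (Suc n)) v) =
      smul (of_real ((real n + 1) * (2 * h + real n)) + of_real (2 * (h + real (Suc n)))) ((e ^^ Suc n) v)"
    by (simp add: scale_left_distrib)
  also have "complex_of_real ((real n + 1) * (2 * h + real n)) + of_real (2 * (h + real (Suc n))) =
      of_real ((real (Suc n) + 1) * (2 * h + real (Suc n)))"
    by (simp add: algebra_simps)
  finally show ?case .
qed

lemma generated_by_lowest:
  assumes bounded: "\<And>h. h \<le> N \<Longrightarrow> K h = {0}"
    and half_integer: "\<And>m::nat. K (- real (Suc m) / 2) = {0}"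
    and weight_one: "\<And>v. v \<in> K 1 \<Longrightarrow> f v = 0"
    and "v \<in> K h"
  shows "v \<in> span {(e ^^ i) x | i x. x \<in> K (h - real i) \<and> f x = 0}"
proof -
  define G where "G h = {(e ^^ i) x | i x. x \<in> K (h - real i) \<and> f x = 0}" for h
  have G_K: "G h \<subseteq> K h" for h
  proof
    fix y assume "y \<in> G h"
    then obtain i x where "y = (e ^^ i) x" "x \<in> K (h - real i)"
      by (auto simp: G_def)
    then show "y \<in> K h"
      using e_power_degree[of x "h - real i" i] by simp
  qed
  have lift: "\<exists>v\<in>span (G h). f v = y" if "y \<in> span (G (h - 1))" "h \<noteq> 1" for y h
    using that(1)
  proof (induction rule: span_induct_alt)
    case base
    show ?case
      by (rule bexI[of _ 0]) (simp_all add: span_zero f.zero)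
  next
    case (step c y z)
    then obtain v where v: "v \<in> span (G h)" "f v = z"
      by blast
    obtain i x where x: "y = (e ^^ i) x" "x \<in> K (h - 1 - real i)" "f x = 0"
      using step(1) by (auto simp: G_def)
    define k where "k = (real i + 1) * (2 * (h - 1 - real i) + real i)"
    \<comment> \<open>\<open>k\<close> is the factor in \<open>f (e\<^sup>i\<^sup>+\<^sup>1 x) = k e\<^sup>i x\<close>\<close>
    show ?case
    proof (cases "k = 0")
      case True
      then have "2 * (h - 1 - real i) + real i = 0"
        unfolding k_def mult_eq_0_iff by linarith
      then have "h - 1 - real i = - real i / 2"
        by (simp add: field_simps)
      moreover have "i \<noteq> 0"
        using calculation \<open>h \<noteq> 1\<close> by auto
      ultimately have "x \<in> {0}"
        using x(2) half_integer[of "i - 1"] by simp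
      then have "y = 0"
        using x(1) e_power_zero by simp
      then show ?thesis
        using v by auto
    next
      case False
      have "(e ^^ Suc i) x \<in> G h"
        unfolding G_def using x(2,3) by (intro CollectI exI[of _ "Suc i"] exI[of _ x]) (simp add: algebra_simps)
      then have "smul (c / of_real k) ((e ^^ Suc i) x) + v \<in> span (G h)"
        using v(1) by (blast intro: span_add span_scale span_base)
      moreover have "f (smul (c / of_real k) ((e ^^ Suc i) x) + v) = smul c y + z"
        using lower_raise[OF x(2,3), of i] False v(2) x(1) by (simp only: f.add f.scale k_def[symmetric]) simp
      ultimately show ?thesis
        by blast
    qed
  qed
  have "v \<in> span (G h)" if "h \<le> N + real n" "v \<in> K h" for n v h
    using that
  proof (induction n arbitrary: h v)
    case 0
    then have "v = 0"
      using bounded by auto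
    then show ?case
      by (simp add: span_zero)
  next
    case (Suc n)
    obtain w where w: "w \<in> span (G h)" "f w = f v"
    proof (cases "h = 1")
      case True
      then show ?thesis
        using weight_one Suc.prems(2) that[of 0] by (simp add: span_zero f.zero)
    next
      case False
      have "f v \<in> span (G (h - 1))"
        using Suc.prems f_degree by (intro Suc.IH) auto
      then show ?thesis
        using lift[OF _ False] that by blast
    qed
    have "w \<in> K h"
      using w(1) span_minimal[OF G_K subspace_K] by blast
    then have "v - w \<in> K (h - real 0)"
      using Suc.prems(2) subspace_K subspace_diff by simp
    then have "v - w \<in> G h"
      unfolding G_def using w(2) by (intro CollectI exI[of _ 0] exI[of _ "v - w"]) (simp add: f.diff)
    then have "(v - w) + w \<in> span (G h)"
      using w(1) by (blast intro: span_add span_base)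
    then show ?case
      by simp
  qed
  moreover obtain n where "h - N \<le> real n"
    using real_arch_simple by blast
  ultimately show ?thesis
    using \<open>v \<in> K h\<close> unfolding G_def[symmetric] by (metis add.commute diff_le_eq)
qed

end

text \<open>The bigraded space with its two commuting Virasoro actions and a nondegenerate form for which the
  adjoint of a mode is the opposite mode. The assumptions are symmetric under exchanging the two
  actions together with the two gradings, so every statement about \<open>L\<close> has a conjugate.\<close>

locale conformal_form = vector_space smul
  for smul :: "complex \<Rightarrow> 'v::ab_group_add \<Rightarrow> 'v" +
  fixes F :: "real \<Rightarrow> real \<Rightarrow> 'v set" and L Lb :: "int \<Rightarrow> 'v \<Rightarrow> 'v"
    and form :: "'v \<Rightarrow> 'v \<Rightarrow> complex"
  assumes subspace_F: "subspace (F h hb)"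
    and span_F: "span (\<Union>h hb. F h hb) = UNIV"
    and bounded: "\<exists>N. \<forall>h hb. h \<le> N \<or> hb \<le> N \<longrightarrow> F h hb = {0}"
    and linear_L: "Vector_Spaces.linear smul smul (L n)"
    and linear_Lb: "Vector_Spaces.linear smul smul (Lb n)"
    and L_degree: "v \<in> F h hb \<Longrightarrow> L n v \<in> F (h - of_int n) hb"
    and Lb_degree: "v \<in> F h hb \<Longrightarrow> Lb n v \<in> F h (hb - of_int n)"
    and L_zero: "v \<in> F h hb \<Longrightarrow> L 0 v = smul (of_real h) v"
    and Lb_zero: "v \<in> F h hb \<Longrightarrow> Lb 0 v = smul (of_real hb) v"
    and virasoro_L: "\<exists>c. virasoro_relations smul L c"
    and virasoro_Lb: "\<exists>c. virasoro_relations smul Lb c"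
    and L_Lb_commute: "L n (Lb m v) = Lb m (L n v)"
    and form_linear_left: "Vector_Spaces.linear smul (*) (\<lambda>v. form v w)"
    and form_linear_right: "Vector_Spaces.linear smul (*) (\<lambda>w. form v w)"
    and L_adjoint: "form (L n v) w = form v (L (- n) w)"
    and Lb_adjoint: "form (Lb n v) w = form v (Lb (- n) w)"
    and nondegenerate: "nondegenerate_form form"
begin

sublocale L: Vector_Spaces.linear smul smul "L n" for n
  by (rule linear_L)

sublocale Lb: Vector_Spaces.linear smul smul "Lb n" for n
  by (rule linear_Lb)

sublocale form_left: Vector_Spaces.linear smul "(*)" "\<lambda>v. form v w" for w
  by (rule form_linear_left)

sublocale form_right: Vector_Spaces.linear smul "(*)" "\<lambda>w. form v w" for v
  by (rule form_linear_right)

lemma conformal_form_swap: "conformal_form smul (\<lambda>h hb. F hb h) Lb L form"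
proof
  show "subspace (F hb h)" for h hb
    by (rule subspace_F)
  show "span (\<Union>h hb. F hb h) = UNIV"
    using span_F by (metis SUP_commute)
  show "\<exists>N. \<forall>h hb. h \<le> N \<or> hb \<le> N \<longrightarrow> F hb h = {0}"
    using bounded by blast
qed (simp_all add: L.add L.scale Lb.add Lb.scale L_degree Lb_degree L_zero Lb_zero virasoro_L virasoro_Lb
    L_Lb_commute form_left.add form_left.scale form_right.add form_right.scale L_adjoint Lb_adjoint nondegenerate)

lemma L_commutators:
  "L 1 (L (- 1) v) - L (- 1) (L 1 v) = smul 2 (L 0 v)"
  "L 2 (L (- 1) v) - L (- 1) (L 2 v) = smul 3 (L 1 v)"
proof -
  obtain c where c: "virasoro_relations smul L c"
    using virasoro_L by blast
  show "L 1 (L (- 1) v) - L (- 1) (L 1 v) = smul 2 (L 0 v)"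
    "L 2 (L (- 1) v) - L (- 1) (L 2 v) = smul 3 (L 1 v)"
    using c[unfolded virasoro_relations_def, rule_format, of 1 "- 1" v]
      c[unfolded virasoro_relations_def, rule_format, of 2 "- 1" v] by simp_all
qed

lemma sl2_action_L: "sl2_action smul (\<lambda>h. F h hb) (L (- 1)) (L 1)"
proof
  fix v h assume v: "v \<in> F h hb"
  show "L (- 1) v \<in> F (h + 1) hb" "L 1 v \<in> F (h - 1) hb"
    using L_degree[OF v, of "- 1"] L_degree[OF v, of 1] by simp_all
  show "L 1 (L (- 1) v) - L (- 1) (L 1 v) = smul (of_real (2 * h)) v"
    unfolding L_commutators L_zero[OF v] by simp
qed (simp_all add: subspace_F L.add L.scale)

lemma Lb_power_commute: "L n ((Lb m ^^ j) v) = (Lb m ^^ j) (L n v)"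
  by (induction j) (simp_all add: L_Lb_commute)

lemma L_power_Lb_power_commute: "(L n ^^ i) ((Lb m ^^ j) v) = (Lb m ^^ j) ((L n ^^ i) v)"
  by (induction i) (simp_all add: Lb_power_commute)

lemma L_power_zero: "(L n ^^ i) 0 = 0"
  by (induction i) (simp_all add: L.zero)

lemma Lb_power_zero: "(Lb n ^^ i) 0 = 0"
  by (induction i) (simp_all add: Lb.zero)

lemma form_L_power: "form ((L n ^^ i) v) w = form v ((L (- n) ^^ i) w)"
  by (induction i arbitrary: v w) (simp_all add: L_adjoint funpow_swap1)

definition quasi_primary :: "'v \<Rightarrow> bool" where
  "quasi_primary x \<longleftrightarrow> L 1 x = 0 \<and> Lb 1 x = 0"

text \<open>A vector orthogonal to all descendants of quasi-primary vectors vanishes; this is the only consequence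
  of QP-generation that enters. Quasi-primary vectors need not be homogeneous here.\<close>

definition descendants_separate :: bool where
  "descendants_separate \<longleftrightarrow>
     (\<forall>w. (\<forall>i j x. quasi_primary x \<longrightarrow> form w ((L (- 1) ^^ i) ((Lb (- 1) ^^ j) x)) = 0) \<longrightarrow> w = 0)"

lemma descendant_zero:
  assumes sep: "descendants_separate" and w: "w = (L (- 1) ^^ Suc n) v" "L 1 w = 0"
  shows "w = 0"
proof -
  have "form w ((L (- 1) ^^ i) ((Lb (- 1) ^^ j) x)) = 0" if "quasi_primary x" for i j x
  proof (cases i)
    case 0
    have "(L 1 ^^ Suc n) ((Lb (- 1) ^^ j) x) = 0"
      using \<open>quasi_primary x\<close>
      by (simp add: quasi_primary_def funpow_swap1[of _ n] Lb_power_commute Lb_power_zero L_power_zero)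
    then show ?thesis
      using form_L_power[where n = "- 1" and i = "Suc n" and v = v] by (simp add: 0 w(1) form_right.zero del: funpow.simps)
  next
    case (Suc i')
    then show ?thesis
      using L_adjoint[of 1 w] by (simp add: w(2) form_left.zero)
  qed
  then show ?thesis
    using sep unfolding descendants_separate_def by blast
qed

text \<open>Since \<open>[L(2), L(-1)] = 3 L(1)\<close>, moving \<open>L(2)\<close> through \<open>L(-1)\<^sup>n\<close> produces \<open>L(1) L(-1)\<^sup>i v\<close> for \<open>i < n\<close>. For \<open>n < 2\<close> the
  coefficient is zero, so the truncated exponent \<open>n - 2\<close> is harmless.\<close>

lemma L_two_raise:
  assumes "v \<in> F h hb" "L 1 v = 0" "L 2 v = 0"
  shows "L 2 ((L (- 1) ^^ n) v) =
     smul (of_real (3 * (\<Sum>i<n. real i * (2 * h + real i - 1)))) ((L (- 1) ^^ (n - 2)) v)"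
proof -
  interpret sl2_action smul "\<lambda>h. F h hb" "L (- 1)" "L 1"
    by (rule sl2_action_L)
  have lower: "L 1 ((L (- 1) ^^ n) v) = smul (of_real (real n * (2 * h + real n - 1))) ((L (- 1) ^^ (n - 1)) v)" for n
  proof (cases n)
    case 0
    then show ?thesis
      using assms(2) by simp
  next
    case (Suc k)
    then show ?thesis
      using lower_raise[OF assms(1,2), of k] by (simp add: add_ac)
  qed
  show ?thesis
  proof (induction n)
    case 0
    show ?case
      using assms(3) by simp
  next
    case (Suc n)
    let ?s = "\<lambda>n. \<Sum>i<n. real i * (2 * h + real i - 1)"
    have "L (- 1) (L 2 ((L (- 1) ^^ n) v)) = smul (of_real (3 * ?s n)) ((L (- 1) ^^ (n - 1)) v)"
    proof (cases "n < 2")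
      case True
      then have "?s n = 0"
        by (cases n) auto
      then show ?thesis
        by (simp add: Suc.IH L.zero)
    next
      case False
      then have "n - 1 = Suc (n - 2)"
        by simp
      then show ?thesis
        by (simp add: Suc.IH L.scale)
    qed
    then have "L 2 ((L (- 1) ^^ Suc n) v) = smul (of_real (3 * ?s n)) ((L (- 1) ^^ (n - 1)) v) +
        smul 3 (smul (of_real (real n * (2 * h + real n - 1))) ((L (- 1) ^^ (n - 1)) v))"
      using L_commutators(2)[of "(L (- 1) ^^ n) v"] by (simp add: lower algebra_simps)
    then show ?case
      by (simp add: scale_left_distrib[symmetric] distrib_left)
  qed
qed

lemma negative_half_integer_lowest_zero:
  assumes sep: "descendants_separate"
    and v: "v \<in> F (- real (Suc m) / 2) hb" "L 1 v = 0" "L 2 v = 0"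
  shows "v = 0"
proof -
  interpret sl2_action smul "\<lambda>h. F h hb" "L (- 1)" "L 1"
    by (rule sl2_action_L)
  have "L 1 ((L (- 1) ^^ Suc (Suc m)) v) = 0"
  proof -
    have "(real (Suc m) + 1) * (2 * (- real (Suc m) / 2) + real (Suc m)) = 0"
      by (simp add: field_simps)
    then show ?thesis
      using lower_raise[OF v(1,2), of "Suc m"] by (simp only: of_real_0 scale_zero_left)
  qed
  then have "(L (- 1) ^^ Suc (Suc m)) v = 0"
    using descendant_zero[OF sep refl] by blast
  then have "smul (of_real (3 * (\<Sum>i<Suc (Suc m). real i * (2 * (- real (Suc m) / 2) + real i - 1))))
      ((L (- 1) ^^ m) v) = 0"
    using L_two_raise[OF v, of "Suc (Suc m)"] L.zero by (simp del: funpow.simps)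
  moreover have "(\<Sum>i<Suc (Suc m). real i * (2 * (- real (Suc m) / 2) + real i - 1)) < 0"
  proof -
    have "(\<Sum>i<Suc (Suc m). real i * (2 * (- real (Suc m) / 2) + real i - 1)) < (\<Sum>i<Suc (Suc m). 0)"
    proof (rule sum_strict_mono_ex1)
      show "\<forall>i\<in>{..<Suc (Suc m)}. real i * (2 * (- real (Suc m) / 2) + real i - 1) \<le> 0"
      proof
        fix i assume "i \<in> {..<Suc (Suc m)}"
        then have "2 * (- real (Suc m) / 2) + real i - 1 \<le> 0"
          by (simp add: field_simps)
        then show "real i * (2 * (- real (Suc m) / 2) + real i - 1) \<le> 0"
          by (intro mult_nonneg_nonpos) simp_all
      qed
      show "\<exists>i\<in>{..<Suc (Suc m)}. real i * (2 * (- real (Suc m) / 2) + real i - 1) < 0"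
        by (rule bexI[of _ 1]) auto
    qed simp
    then show ?thesis
      by simp
  qed
  ultimately have "(L (- 1) ^^ m) v = 0"
    by (simp only: scale_eq_0_iff of_real_eq_0_iff) auto
  \<comment> \<open>\<open>L(1)\<close> lowers the exponent, as \<open>n + 1 \<le> m\<close> keeps the factor \<open>(n + 1) (n - m - 1)\<close> nonzero\<close>
  moreover have "v = 0" if "(L (- 1) ^^ n) v = 0" "n \<le> m" for n
    using that
  proof (induction n)
    case (Suc n)
    have "smul (of_real ((real n + 1) * (2 * (- real (Suc m) / 2) + real n))) ((L (- 1) ^^ n) v) = 0"
      using lower_raise[OF v(1,2), of n] Suc.prems(1) L.zero by simp
    moreover have "2 * (- real (Suc m) / 2) + real n < 0"
      using Suc.prems(2) by (simp add: field_simps)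
    then have "(real n + 1) * (2 * (- real (Suc m) / 2) + real n) \<noteq> 0"
      by simp
    ultimately have "(L (- 1) ^^ n) v = 0"
      unfolding scale_eq_0_iff of_real_eq_0_iff by blast
    then show ?case
      using Suc by simp
  qed simp
  ultimately show ?thesis
    by blast
qed

lemma negative_half_integer_zero:
  assumes "descendants_separate"
  shows "F (- real (Suc m) / 2) hb = {0}"
proof -
  obtain N where N: "\<And>h hb. h \<le> N \<Longrightarrow> F h hb = {0}"
    using bounded by blast
  have "F (- real (Suc m) / 2) hb = {0}" if "- real (Suc m) / 2 \<le> N + real n" for n m
    using that
  proof (induction n arbitrary: m)
    case 0
    then show ?case
      using N by simp
  next
    case (Suc n)
    \<comment> \<open>the weights below \<open>h\<close> in its coset of the integers are again negative half-integers\<close>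
    have shift: "- real (Suc m) / 2 - of_int k = - real (Suc (m + nat (2 * k))) / 2" if "k > 0" for k
      using that by (simp add: field_simps)
    have zero: "F (- real (Suc m) / 2 - of_int k) hb = {0}" if "k > 0" for k
      unfolding shift[OF that] by (rule Suc.IH) (use shift[OF that] Suc.prems that in linarith)
    have "L k v = 0" if "v \<in> F (- real (Suc m) / 2) hb" "k > 0" for k v
      using L_degree[OF that(1), of k] zero[OF that(2)] by (simp only: singleton_iff)
    then have "L 1 v = 0" "L 2 v = 0" if "v \<in> F (- real (Suc m) / 2) hb" for v
      using that by simp_all
    then show ?case
      using negative_half_integer_lowest_zero[OF assms] subspace_0[OF subspace_F] by blast
  qed
  moreover obtain n where "- real (Suc m) / 2 - N \<le> real n"
    using real_arch_simple by blast
  ultimately show ?thesis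
    by (metis add.commute diff_le_eq)
qed

lemma L_minus_one_weight_zero:
  assumes "descendants_separate" "v \<in> F 0 hb"
  shows "L (- 1) v = 0"
proof -
  have "L 1 v \<in> F (- real (Suc 1) / 2) hb"
    using L_degree[OF assms(2), of 1] by simp
  then have "L 1 v = 0"
    using negative_half_integer_zero[OF assms(1), of 1] by simp
  then have "L 1 (L (- 1) v) = 0"
    using L_commutators(1)[of v] L_zero[OF assms(2)] by (simp add: L.zero)
  then show ?thesis
    using descendant_zero[OF assms(1), of "L (- 1) v" 0 v] by simp
qed

lemma form_eq_zeroI:
  assumes "\<And>h hb w. w \<in> F h hb \<Longrightarrow> form v w = 0"
  shows "v = 0"
proof -
  have "form v w = 0" for w
  proof -
    have "w \<in> span (\<Union>h hb. F h hb)"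
      using span_F by simp
    then show ?thesis
      by (induction rule: span_induct_alt) (use assms in \<open>auto simp: form_right.add form_right.scale form_right.zero\<close>)
  qed
  then show ?thesis
    using nondegenerate by (simp add: nondegenerate_form_def)
qed

lemma form_orthogonal:
  assumes "v \<in> F h hb" "w \<in> F h' hb'" "h \<noteq> h'"
  shows "form v w = 0"
proof -
  have "form (L 0 v) w = form v (L 0 w)"
    using L_adjoint[of 0] by simp
  then have "of_real h * form v w = of_real h' * form v w"
    unfolding L_zero[OF assms(1)] L_zero[OF assms(2)]
    by (simp add: form_left.scale form_right.scale)
  then show ?thesis
    using assms(3) by simp
qed

text \<open>The adjoint of the vanishing of \<open>L(-1)\<close> in weight \<open>0\<close>, since weight spaces of different weight are
  orthogonal.\<close>

lemma L_one_weight_one: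
  assumes "descendants_separate" "v \<in> F 1 hb"
  shows "L 1 v = 0"
proof (rule form_eq_zeroI)
  fix h' hb' w assume w: "w \<in> F h' hb'"
  have "L 1 v \<in> F 0 hb"
    using L_degree[OF assms(2), of 1] by simp
  show "form (L 1 v) w = 0"
  proof (cases "h' = 0")
    case True
    then show ?thesis
      using L_minus_one_weight_zero[OF assms(1)] w by (simp add: L_adjoint form_right.zero)
  next
    case False
    then show ?thesis
      using form_orthogonal[OF \<open>L 1 v \<in> F 0 hb\<close> w] by simp
  qed
qed

lemma sl2_action_Lb_kernel: "sl2_action smul (\<lambda>hb. {v \<in> F h hb. L 1 v = 0}) (Lb (- 1)) (Lb 1)"
proof
  interpret swap: conformal_form smul "\<lambda>h hb. F hb h" Lb L form
    by (rule conformal_form_swap)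
  interpret sl2_action smul "\<lambda>hb. F h hb" "Lb (- 1)" "Lb 1"
    by (rule swap.sl2_action_L)
  show "subspace {v \<in> F h hb. L 1 v = 0}" for hb
    using subspace_F[of h hb] unfolding subspace_def by (auto simp: L.add L.scale L.zero)
  show "Lb (- 1) v \<in> {v \<in> F h (hb + 1). L 1 v = 0}" if "v \<in> {v \<in> F h hb. L 1 v = 0}" for v hb
    using that e_degree by (auto simp: L_Lb_commute Lb.zero)
  show "Lb 1 v \<in> {v \<in> F h (hb - 1). L 1 v = 0}" if "v \<in> {v \<in> F h hb. L 1 v = 0}" for v hb
    using that f_degree by (auto simp: L_Lb_commute Lb.zero)
  show "Lb 1 (Lb (- 1) v) - Lb (- 1) (Lb 1 v) = smul (of_real (2 * hb)) v"
    if "v \<in> {v \<in> F h hb. L 1 v = 0}" for v hb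
    using that commutator by simp
qed

lemma spanned_by_descendants:
  assumes half_integer: "\<And>m h hb. h = - real (Suc m) / 2 \<or> hb = - real (Suc m) / 2 \<Longrightarrow> F h hb = {0}"
    and L_one: "\<And>hb v. v \<in> F 1 hb \<Longrightarrow> L 1 v = 0"
    and Lb_one: "\<And>h v. v \<in> F h 1 \<Longrightarrow> Lb 1 v = 0"
  shows "span {(L (- 1) ^^ i) ((Lb (- 1) ^^ j) x) | i j x. \<exists>h hb. x \<in> F h hb \<and> quasi_primary x} = UNIV"
    (is "span ?D = UNIV")
proof -
  obtain N where N: "\<And>h hb. h \<le> N \<or> hb \<le> N \<Longrightarrow> F h hb = {0}"
    using bounded by blast
  have kernel: "(L (- 1) ^^ i) x \<in> span ?D" if x: "x \<in> F h hb" "L 1 x = 0" for i x h hb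
  proof -
    interpret sl2_action smul "\<lambda>hb. {v \<in> F h hb. L 1 v = 0}" "Lb (- 1)" "Lb 1"
      by (rule sl2_action_Lb_kernel)
    have "x \<in> span {(Lb (- 1) ^^ j) y | j y. y \<in> {v \<in> F h (hb - real j). L 1 v = 0} \<and> Lb 1 y = 0}"
    proof (rule generated_by_lowest[of N])
      show "{v \<in> F h hb. L 1 v = 0} = {0}" if "hb \<le> N" for hb
        using N[of hb h] that N by (auto simp: L.zero)
      show "{v \<in> F h (- real (Suc m) / 2). L 1 v = 0} = {0}" for m
        using half_integer[of h m] by (auto simp: L.zero)
      show "Lb 1 v = 0" if "v \<in> {v \<in> F h 1. L 1 v = 0}" for v
        using that Lb_one by blast
    qed (use x in simp)
    then show ?thesis
    proof (induction rule: span_induct_alt)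
      case base
      show ?case
        by (simp add: L_power_zero span_zero)
    next
      case (step c y z)
      then have "(L (- 1) ^^ i) y \<in> ?D"
        unfolding quasi_primary_def by blast
      moreover have "(L (- 1) ^^ i) (smul c y + z) = smul c ((L (- 1) ^^ i) y) + (L (- 1) ^^ i) z"
        by (induction i) (simp_all add: L.add L.scale)
      ultimately show ?case
        using step(2) by (simp add: span_add span_scale span_base)
    qed
  qed
  have "v \<in> span ?D" if "v \<in> F h hb" for v h hb
  proof -
    interpret sl2_action smul "\<lambda>h. F h hb" "L (- 1)" "L 1"
      by (rule sl2_action_L)
    have "v \<in> span {(L (- 1) ^^ i) x | i x. x \<in> F (h - real i) hb \<and> L 1 x = 0}"
    proof (rule generated_by_lowest[of N])
      show "F (- real (Suc m) / 2) hb = {0}" for m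
        by (rule half_integer[of _ m]) simp
    qed (use N L_one that in auto)
    also have "\<dots> \<subseteq> span ?D"
      by (rule span_minimal) (use kernel in auto)
    finally show ?thesis .
  qed
  then have "span (\<Union>h hb. F h hb) \<subseteq> span ?D"
    by (intro span_minimal) auto
  then have "UNIV \<subseteq> span ?D"
    unfolding span_F .
  then show ?thesis
    by blast
qed

end

section \<open>The modes of the conformal vectors\<close>

lemma word_sum_eq:
  assumes "A v = 0" "B v = 0" "A 0 = 0" "B 0 = 0"
  shows "word_sum A B i j v = (if i = 0 \<and> j = 0 then v else 0)"
  using assms by (induction A B i j v rule: word_sum.induct) auto

context full_vertex_algebra
begin

sublocale Y_left: Vector_Spaces.linear smul smul "\<lambda>a. Y a r s b" for r s b
  by (rule Y_linear_left)

sublocale Y_right: Vector_Spaces.linear smul smul "\<lambda>b. Y a r s b" for a r s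
  by (rule Y_linear_right)

lemma subspace_F: "subspace (F h hb)"
  using grading by (simp add: direct_sum_grading_def)

text \<open>The family \<open>c\<close> of homogeneous vectors is the decomposition of \<open>v\<close>.\<close>

definition components_of :: "(real \<times> real \<Rightarrow> 'v) \<Rightarrow> 'v \<Rightarrow> bool" where
  "components_of c v \<longleftrightarrow>
     finite {p. c p \<noteq> 0} \<and> (\<forall>h hb. c (h, hb) \<in> F h hb) \<and> (\<Sum>p | c p \<noteq> 0. c p) = v"

lemma ex1_components: "\<exists>!c. components_of c v"
  using grading unfolding direct_sum_grading_def components_of_def by blast

definition component :: "'v \<Rightarrow> real \<times> real \<Rightarrow> 'v" where
  "component v = (THE c. components_of c v)"

lemma components_of_component: "components_of (component v) v"
  unfolding component_def by (rule theI'[OF ex1_components])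

lemma component_eqI: "components_of c v \<Longrightarrow> component v = c"
  using ex1_components components_of_component by blast

lemma components_ofI:
  assumes "finite S" "\<And>p. p \<notin> S \<Longrightarrow> c p = 0" "\<And>h hb. c (h, hb) \<in> F h hb" "(\<Sum>p\<in>S. c p) = v"
  shows "components_of c v"
proof -
  have "{p. c p \<noteq> 0} \<subseteq> S"
    using assms(2) by blast
  then have "finite {p. c p \<noteq> 0}" "(\<Sum>p | c p \<noteq> 0. c p) = (\<Sum>p\<in>S. c p)"
    using assms(1) by (auto intro: finite_subset sum.mono_neutral_left)
  then show ?thesis
    using assms(3,4) unfolding components_of_def by simp
qed

lemma finite_component: "finite {p. component v p \<noteq> 0}"
  and component_in_F: "component v (h, hb) \<in> F h hb"
  and sum_component: "(\<Sum>p | component v p \<noteq> 0. component v p) = v"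
  using components_of_component[of v] unfolding components_of_def by blast+

lemma sum_component_superset:
  assumes "finite S" "{p. component v p \<noteq> 0} \<subseteq> S"
  shows "(\<Sum>p\<in>S. component v p) = v"
proof -
  have "(\<Sum>p\<in>S. component v p) = (\<Sum>p | component v p \<noteq> 0. component v p)"
    using assms by (intro sum.mono_neutral_right) auto
  then show ?thesis
    by (simp add: sum_component)
qed

lemma component_add: "component (v + w) = (\<lambda>p. component v p + component w p)"
proof (rule component_eqI, rule components_ofI)
  let ?S = "{p. component v p \<noteq> 0} \<union> {p. component w p \<noteq> 0}"
  show "finite ?S"
    by (simp add: finite_component)
  show "(\<Sum>p\<in>?S. component v p + component w p) = v + w"
    using finite_component[of v] finite_component[of w]
    by (simp add: sum.distrib sum_component_superset)
qed (auto intro: subspace_add subspace_F component_in_F)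

lemma component_scale: "component (smul k v) = (\<lambda>p. smul k (component v p))"
proof (rule component_eqI, rule components_ofI[OF finite_component])
  show "(\<Sum>p | component v p \<noteq> 0. smul k (component v p)) = smul k v"
    by (simp only: scale_sum_right[symmetric] sum_component)
qed (auto intro: subspace_scale subspace_F component_in_F)

lemma component_homogeneous:
  assumes "v \<in> F h hb"
  shows "component v = (\<lambda>p. if p = (h, hb) then v else 0)"
  by (rule component_eqI, rule components_ofI[of "{(h, hb)}"])
    (use assms in \<open>auto simp: subspace_0[OF subspace_F]\<close>)

lemma span_homogeneous: "span (\<Union>h hb. F h hb) = UNIV"
proof -
  have "v \<in> span (\<Union>h hb. F h hb)" for v
  proof -
    have "component v p \<in> span (\<Union>h hb. F h hb)" for p
      using component_in_F[of v "fst p" "snd p"] by (intro span_base) auto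
    then have "(\<Sum>p | component v p \<noteq> 0. component v p) \<in> span (\<Union>h hb. F h hb)"
      by (intro span_sum)
    then show ?thesis
      by (simp add: sum_component)
  qed
  then show ?thesis
    by blast
qed

lemma component_eigenvector:
  assumes T: "Vector_Spaces.linear smul smul T"
    and weight: "\<And>h hb x. x \<in> F h hb \<Longrightarrow> T x = smul (of_real (wt (h, hb))) x"
    and v: "T v = smul (of_real w0) v" and p: "component v p \<noteq> 0"
  shows "wt p = w0"
proof -
  interpret T: Vector_Spaces.linear smul smul T
    by (rule T)
  define c where "c p = smul (of_real (wt p - w0)) (component v p)" for p
  have T_component: "T (component v p) = smul (of_real (wt p)) (component v p)" for p
    using weight[OF component_in_F[of v "fst p" "snd p"]] by simp
  have "components_of c (T v - smul (of_real w0) v)"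
  proof (rule components_ofI[OF finite_component])
    have "(\<Sum>p | component v p \<noteq> 0. c p) =
        T (\<Sum>p | component v p \<noteq> 0. component v p) - smul (of_real w0) (\<Sum>p | component v p \<noteq> 0. component v p)"
      unfolding c_def T.sum scale_sum_right T_component
      by (simp add: sum_subtractf scale_left_diff_distrib)
    then show "(\<Sum>p | component v p \<noteq> 0. c p) = T v - smul (of_real w0) v"
      by (simp only: sum_component)
  qed (auto simp: c_def intro: subspace_scale subspace_F component_in_F)
  then have "component 0 = c"
    using component_eqI v by simp
  moreover have "component 0 = (\<lambda>_. 0)"
    by (rule component_eqI, rule components_ofI[of "{}"]) (auto simp: subspace_0[OF subspace_F])
  ultimately have "c p = 0"
    by metis
  then show ?thesis
    using p by (simp add: c_def)
qed

text \<open>A linear functional composed with the projection to one homogeneous component lies in the restricted dual.\<close>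

lemma restricted_dual_separates:
  assumes "\<And>u. u \<in> restricted_dual smul F \<Longrightarrow> u v = u w"
  shows "v = w"
proof (rule ccontr)
  assume "v \<noteq> w"
  have "\<exists>p. component (v - w) p \<noteq> 0"
  proof (rule ccontr)
    assume "\<not> (\<exists>p. component (v - w) p \<noteq> 0)"
    then have "{p. component (v - w) p \<noteq> 0} = {}"
      by blast
    then have "v - w = 0"
      using sum_component[of "v - w"] by (simp only: sum.empty)
    then show False
      using \<open>v \<noteq> w\<close> by simp
  qed
  then obtain p where p: "component (v - w) p \<noteq> 0"
    by blast
  interpret vector_space_pair smul "(*) :: complex \<Rightarrow> complex \<Rightarrow> complex"
    by unfold_locales (auto simp: algebra_simps)
  define \<phi> where "\<phi> = construct {component (v - w) p} (\<lambda>_. 1 :: complex)"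
  have indep: "independent {component (v - w) p}"
    using p by simp
  have "Vector_Spaces.linear smul (*) \<phi>"
    unfolding \<phi>_def by (rule linear_construct[OF indep])
  then interpret \<phi>: Vector_Spaces.linear smul "(*)" \<phi> .
  have "\<phi> (component (v - w) p) = 1"
    unfolding \<phi>_def by (rule construct_basis[OF indep]) simp
  define u where "u x = \<phi> (component x p)" for x
  have "Vector_Spaces.linear smul (*) u"
    by unfold_locales (simp_all add: u_def component_add component_scale \<phi>.add \<phi>.scale)
  moreover have "{(h, hb). \<exists>x\<in>F h hb. u x \<noteq> 0} \<subseteq> {p}"
    by (auto simp: u_def component_homogeneous \<phi>.zero split: if_splits)
  then have "finite {(h, hb). \<exists>x\<in>F h hb. u x \<noteq> 0}"
    using finite_subset by blast
  ultimately have "u \<in> restricted_dual smul F"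
    by (simp add: restricted_dual_def)
  then interpret u: Vector_Spaces.linear smul "(*)" u
    by (simp add: restricted_dual_def)
  have "u (v - w) = 0"
    using assms[OF \<open>u \<in> restricted_dual smul F\<close>] by (simp add: u.diff)
  then show False
    using \<open>\<phi> (component (v - w) p) = 1\<close> by (simp add: u_def)
qed

lemma restricted_dual_zero: "u \<in> restricted_dual smul F \<Longrightarrow> u 0 = 0"
  unfolding restricted_dual_def
  using module_hom.zero[of smul "(*)" u] by (simp add: module_hom_iff_linear)

lemma restricted_dual_scale: "u \<in> restricted_dual smul F \<Longrightarrow> u (smul k v) = k * u v"
  unfolding restricted_dual_def
  using module_hom.scale[of smul "(*)" u] by (simp add: module_hom_iff_linear)

lemma mode_integral: "Y a r s b \<noteq> 0 \<Longrightarrow> r - s \<in> \<int>"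
proof -
  assume "Y a r s b \<noteq> 0"
  then have "(- r - 1, - s - 1) \<in> {(r, s). \<exists>b. Y a (- r - 1) (- s - 1) b \<noteq> 0}"
    by auto
  then have "(- r - 1) - (- s - 1) \<in> \<int>"
    using Y_support[of a] unfolding admissible_support_def by blast
  then have "- (r - s) \<in> \<int>"
    by simp
  then show ?thesis
    by (simp only: minus_in_Ints_iff)
qed

text \<open>The translation property \<open>Y(Dbar a, z) = \<partial>Y(a, z)/\<partial>zbar\<close> and \<open>Y(D a, z) = \<partial>Y(a, z)/\<partial>z\<close> in modes: with the vacuum
  as second vector the expansion in \<open>|z\<^sub>1| > |z\<^sub>2|\<close> does not involve \<open>z\<^sub>2\<close>.\<close>

lemma translation:
  "Y (Dbar_op Y vac a) r s c = smul (of_real (- s)) (Y a r (s - 1) c)"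
  "Y (D_op Y vac a) r s c = smul (of_real (- r)) (Y a (r - 1) s c)"
proof -
  have *: "u (Y (Dbar_op Y vac a) r s c) = u (smul (of_real (- s)) (Y a r (s - 1) c)) \<and>
      u (Y (D_op Y vac a) r s c) = u (smul (of_real (- r)) (Y a (r - 1) s c))"
    if u: "u \<in> restricted_dual smul F" and rs: "r - s \<in> \<int>" for u
  proof -
    obtain \<mu> where \<mu>: "GCor2 \<mu>
        (\<lambda>r1 s1 r2 s2. u (Y a (- r1 - 1) (- s1 - 1) (Y vac (- r2 - 1) (- s2 - 1) c)))
        (\<lambda>r0 s0 r2 s2. u (Y (Y a (- r0 - 1) (- s0 - 1) vac) (- r2 - 1) (- s2 - 1) c))
        (\<lambda>r1 s1 r2 s2. u (Y vac (- r2 - 1) (- s2 - 1) (Y a (- r1 - 1) (- s1 - 1) c)))"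
      using FV5[OF u] by blast
    have A: "r2 = 0 \<and> s2 = 0"
      if "u (Y a (- r1 - 1) (- s1 - 1) (Y vac (- r2 - 1) (- s2 - 1) c)) \<noteq> 0" for r1 s1 r2 s2
      using that restricted_dual_zero[OF u] by (auto simp: FV4 Y_right.zero split: if_splits)
    have B: "r0 \<in> \<nat> \<and> s0 \<in> \<nat>"
      if "u (Y (Y a (- r0 - 1) (- s0 - 1) vac) (- r2 - 1) (- s2 - 1) c) \<noteq> 0" for r0 s0 r2 s2
      using that restricted_dual_zero[OF u] FV3_support[of a r0 s0] by (cases "Y a (- r0 - 1) (- s0 - 1) vac = 0") (auto simp: Y_left.zero)
    have int: "r' - s' \<in> \<int>" if "r' - s' = s - r + of_int k" for r' s' k
      using rs that by (metis Ints_add Ints_minus Ints_of_int minus_diff_eq)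
    have "(- r - 1) - (- s) \<in> \<int>" "(- r) - (- s - 1) \<in> \<int>"
      by (rule int[of _ _ "- 1"], simp) (rule int[of _ _ 1], simp)
    note int = this
    have "u (Y (Y a (- 0 - 1) (- 1 - 1) vac) (- (- r - 1) - 1) (- (- s - 1) - 1) c) =
        of_real (- s) * u (Y a (- (- r - 1) - 1) (- (- s) - 1) (Y vac (- 0 - 1) (- 0 - 1) c))"
      by (rule GCor2_translation(1)[OF \<mu> int(1)]) (erule A, erule B)
    moreover have "u (Y (Y a (- 1 - 1) (- 0 - 1) vac) (- (- r - 1) - 1) (- (- s - 1) - 1) c) =
        of_real (- r) * u (Y a (- (- r) - 1) (- (- s - 1) - 1) (Y vac (- 0 - 1) (- 0 - 1) c))"
      by (rule GCor2_translation(2)[OF \<mu> int(2)]) (erule A, erule B)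
    ultimately show ?thesis
      unfolding restricted_dual_scale[OF u] by (simp add: Dbar_op_def D_op_def FV4)
  qed
  have *: "Y (Dbar_op Y vac a) r s c = smul (of_real (- s)) (Y a r (s - 1) c) \<and>
      Y (D_op Y vac a) r s c = smul (of_real (- r)) (Y a (r - 1) s c)"
  proof (cases "r - s \<in> \<int>")
    case True
    have "Y (Dbar_op Y vac a) r s c = smul (of_real (- s)) (Y a r (s - 1) c)"
      by (rule restricted_dual_separates, rule conjunct1[OF *[OF _ True]])
    moreover have "Y (D_op Y vac a) r s c = smul (of_real (- r)) (Y a (r - 1) s c)"
      by (rule restricted_dual_separates, rule conjunct2[OF *[OF _ True]])
    ultimately show ?thesis
      by blast
  next
    case False
    have "r - (s - 1) \<notin> \<int>" "(r - 1) - s \<notin> \<int>"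
      using False Ints_diff[of "r - (s - 1)" 1] Ints_add[of "(r - 1) - s" 1] by auto
    then have "Y (Dbar_op Y vac a) r s c = 0" "Y (D_op Y vac a) r s c = 0"
      "Y a r (s - 1) c = 0" "Y a (r - 1) s c = 0"
      using mode_integral False by blast+
    then show ?thesis
      by simp
  qed
  show "Y (Dbar_op Y vac a) r s c = smul (of_real (- s)) (Y a r (s - 1) c)"
    "Y (D_op Y vac a) r s c = smul (of_real (- r)) (Y a (r - 1) s c)"
    using * by blast+
qed

text \<open>A holomorphic field commutes with an antiholomorphic one: in each degree both products of the two
  fields are multiples of the same monomial \<open>z\<^sub>1\<^sup>R zbar\<^sub>2\<^sup>S\<close>.\<close>

lemma modes_commute:
  assumes a: "Dbar_op Y vac a = 0" and b: "D_op Y vac b = 0"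
  shows "Y a r (- 1) (Y b (- 1) s c) = Y b (- 1) s (Y a r (- 1) c)"
proof (cases "s \<in> \<int>")
  case True
  have a_holomorphic: "s = - 1" if "Y a r s c \<noteq> 0" for r s c
  proof -
    have "smul (of_real (- (s + 1))) (Y a r s c) = 0"
      using translation(1)[of a r "s + 1" c] by (simp add: a Y_left.zero)
    then have "- (s + 1) = 0"
      using that unfolding scale_eq_0_iff of_real_eq_0_iff by blast
    then show ?thesis
      by simp
  qed
  have b_antiholomorphic: "r = - 1" if "Y b r s c \<noteq> 0" for r s c
  proof -
    have "smul (of_real (- (r + 1))) (Y b r s c) = 0"
      using translation(2)[of b "r + 1" s c] by (simp add: b Y_left.zero)
    then have "- (r + 1) = 0"
      using that unfolding scale_eq_0_iff of_real_eq_0_iff by blast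
    then show ?thesis
      by simp
  qed
  show ?thesis
  proof (rule restricted_dual_separates)
    fix u assume u: "u \<in> restricted_dual smul F"
    obtain \<mu> where \<mu>: "GCor2 \<mu>
        (\<lambda>r1 s1 r2 s2. u (Y a (- r1 - 1) (- s1 - 1) (Y b (- r2 - 1) (- s2 - 1) c)))
        (\<lambda>r0 s0 r2 s2. u (Y (Y a (- r0 - 1) (- s0 - 1) b) (- r2 - 1) (- s2 - 1) c))
        (\<lambda>r1 s1 r2 s2. u (Y b (- r2 - 1) (- s2 - 1) (Y a (- r1 - 1) (- s1 - 1) c)))"
      using FV5[OF u] by blast
    have A: "s1 = 0 \<and> r2 = 0"
      if "u (Y a (- r1 - 1) (- s1 - 1) (Y b (- r2 - 1) (- s2 - 1) c)) \<noteq> 0" for r1 s1 r2 s2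
    proof -
      have "Y a (- r1 - 1) (- s1 - 1) (Y b (- r2 - 1) (- s2 - 1) c) \<noteq> 0"
        using that restricted_dual_zero[OF u] by metis
      moreover from this have "Y b (- r2 - 1) (- s2 - 1) c \<noteq> 0"
        using Y_right.zero by metis
      ultimately show ?thesis
        using a_holomorphic b_antiholomorphic by fastforce
    qed
    have C: "s1 = 0 \<and> r2 = 0"
      if "u (Y b (- r2 - 1) (- s2 - 1) (Y a (- r1 - 1) (- s1 - 1) c)) \<noteq> 0" for r1 s1 r2 s2
    proof -
      have "Y b (- r2 - 1) (- s2 - 1) (Y a (- r1 - 1) (- s1 - 1) c) \<noteq> 0"
        using that restricted_dual_zero[OF u] by metis
      moreover from this have "Y a (- r1 - 1) (- s1 - 1) c \<noteq> 0"
        using Y_right.zero by metis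
      ultimately show ?thesis
        using a_holomorphic b_antiholomorphic by fastforce
    qed
    have int: "- s - 1 \<in> \<int>"
      using True by simp
    have "u (Y a (- (- r - 1) - 1) (- 0 - 1) (Y b (- 0 - 1) (- (- s - 1) - 1) c)) =
        u (Y b (- 0 - 1) (- (- s - 1) - 1) (Y a (- (- r - 1) - 1) (- 0 - 1) c))"
      by (rule GCor2_commute[OF \<mu> int]) (erule A, erule C)
    then show "u (Y a r (- 1) (Y b (- 1) s c)) = u (Y b (- 1) s (Y a r (- 1) c))"
      by simp
  qed
next
  case False
  have "- 1 - s \<notin> \<int>"
    using False Ints_minus[of "(- 1 - s) + 1"] Ints_add[of "- 1 - s" 1] by auto
  then have "Y b (- 1) s x = 0" for x
    using mode_integral by blast
  then show ?thesis
    by (simp add: Y_right.zero)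
qed

end

context full_vertex_operator_algebra
begin

abbreviation L where "L \<equiv> L_op Y \<omega>"
abbreviation Lb where "Lb \<equiv> Lbar_op Y \<omega>b"

lemma linear_L: "Vector_Spaces.linear smul smul (L n)"
  unfolding L_op_def by (rule Y_linear_right)

lemma linear_Lb: "Vector_Spaces.linear smul smul (Lb n)"
  unfolding Lbar_op_def by (rule Y_linear_right)

lemma L_Lb_commute: "L n (Lb m v) = Lb m (L n v)"
  unfolding L_op_def Lbar_op_def by (rule modes_commute[OF Dbar_\<omega> D_\<omega>b])

lemma L_vac: "n \<ge> - 1 \<Longrightarrow> L n vac = 0"
proof (rule ccontr)
  assume "n \<ge> - 1" "L n vac \<noteq> 0"
  then have "Y \<omega> (- (- of_int n - 2) - 1) (- 0 - 1) vac \<noteq> 0"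
    by (simp add: L_op_def algebra_simps)
  then have "- real_of_int n - 2 \<in> \<nat>"
    using FV3_support by blast
  then obtain k :: nat where "- real_of_int n - 2 = real k"
    by (elim Nats_cases)
  then show False
    using \<open>n \<ge> - 1\<close> by linarith
qed

lemma Lb_vac: "n \<ge> - 1 \<Longrightarrow> Lb n vac = 0"
proof (rule ccontr)
  assume "n \<ge> - 1" "Lb n vac \<noteq> 0"
  then have "Y \<omega>b (- 0 - 1) (- (- of_int n - 2) - 1) vac \<noteq> 0"
    by (simp add: Lbar_op_def algebra_simps)
  then have "- real_of_int n - 2 \<in> \<nat>"
    using FV3_support by blast
  then obtain k :: nat where "- real_of_int n - 2 = real k"
    by (elim Nats_cases)
  then show False
    using \<open>n \<ge> - 1\<close> by linarith
qed

lemma \<omega>_eq: "\<omega> = L (- 2) vac"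
  by (simp add: L_op_def FV3_constant_term)

lemma \<omega>b_eq: "\<omega>b = Lb (- 2) vac"
  by (simp add: Lbar_op_def FV3_constant_term)

lemma L_zero_right: "L n 0 = 0"
  by (simp add: L_op_def Y_right.zero)

lemma Lb_zero_right: "Lb n 0 = 0"
  by (simp add: Lbar_op_def Y_right.zero)

text \<open>The weights determine the bidegree, also for vectors that are not known to be homogeneous.\<close>

lemma joint_eigenvector:
  assumes "L 0 v = smul (of_real h) v" "Lb 0 v = smul (of_real hb) v"
  shows "v \<in> F h hb"
proof -
  have "p = (h, hb)" if "component v p \<noteq> 0" for p
    using component_eigenvector[OF linear_L, where wt = fst, OF _ assms(1) that] L0
      component_eigenvector[OF linear_Lb, where wt = snd, OF _ assms(2) that] Lbar0
    by (cases p) simp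
  then have "{p. component v p \<noteq> 0} \<subseteq> {(h, hb)}"
    by blast
  then have "v = component v (h, hb)"
    using sum_component_superset[of "{(h, hb)}" v] by simp
  then show ?thesis
    using component_in_F by metis
qed

lemma \<omega>_lowering: "L 0 \<omega> = smul 2 \<omega>" "L 1 \<omega> = 0"
proof -
  obtain c where c: "virasoro_relations smul L c"
    using virasoro by blast
  show "L 0 \<omega> = smul 2 \<omega>" "L 1 \<omega> = 0"
    using c[unfolded virasoro_relations_def, rule_format, of 0 "- 2" vac]
      c[unfolded virasoro_relations_def, rule_format, of 1 "- 2" vac]
    by (simp_all add: L_vac L_zero_right flip: \<omega>_eq)
qed

lemma \<omega>b_lowering: "Lb 0 \<omega>b = smul 2 \<omega>b" "Lb 1 \<omega>b = 0"
proof -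
  obtain c where c: "virasoro_relations smul Lb c"
    using virasoro_bar by blast
  show "Lb 0 \<omega>b = smul 2 \<omega>b" "Lb 1 \<omega>b = 0"
    using c[unfolded virasoro_relations_def, rule_format, of 0 "- 2" vac]
      c[unfolded virasoro_relations_def, rule_format, of 1 "- 2" vac]
    by (simp_all add: Lb_vac Lb_zero_right flip: \<omega>b_eq)
qed

lemma Lb_\<omega>:
  assumes "n \<ge> - 1"
  shows "Lb n \<omega> = 0"
proof -
  have "Lb n \<omega> = Lb n (L (- 2) vac)"
    by (rule arg_cong[OF \<omega>_eq])
  also have "\<dots> = L (- 2) (Lb n vac)"
    by (rule L_Lb_commute[symmetric])
  finally show ?thesis
    using assms by (simp add: Lb_vac L_zero_right)
qed

lemma L_\<omega>b:
  assumes "n \<ge> - 1"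
  shows "L n \<omega>b = 0"
proof -
  have "L n \<omega>b = L n (Lb (- 2) vac)"
    by (rule arg_cong[OF \<omega>b_eq])
  also have "\<dots> = Lb (- 2) (L n vac)"
    by (rule L_Lb_commute)
  finally show ?thesis
    using assms by (simp add: L_vac Lb_zero_right)
qed

lemma \<omega>_degree: "\<omega> \<in> F 2 0"
  by (rule joint_eigenvector) (simp_all add: \<omega>_lowering Lb_\<omega>)

lemma \<omega>b_degree: "\<omega>b \<in> F 0 2"
  by (rule joint_eigenvector) (simp_all add: \<omega>b_lowering L_\<omega>b)

lemma L_degree: "v \<in> F h hb \<Longrightarrow> L n v \<in> F (h - of_int n) hb"
  using FV6[OF \<omega>_degree, of v h hb "of_int (n + 1)" "- 1"] by (simp add: L_op_def algebra_simps)

lemma Lb_degree: "v \<in> F h hb \<Longrightarrow> Lb n v \<in> F h (hb - of_int n)"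
  using FV6[OF \<omega>b_degree, of v h hb "- 1" "of_int (n + 1)"] by (simp add: Lbar_op_def algebra_simps)

text \<open>For a quasi-primary vector only the constant term of the exponential in \<open>S\<^sub>z\<close> survives.\<close>

lemma quasi_primary_adjoint:
  assumes form: "invariant_bilinear_form smul F Y \<omega> \<omega>b form"
    and a: "a \<in> F h hb" "L 1 a = 0" "Lb 1 a = 0"
  shows "form (Y a (- p - 1) (- q - 1) b) c =
     parity_sign (h - hb) * form b (Y a (p - 1 + 2 * h) (q - 1 + 2 * hb) c)"
proof -
  let ?S = "S_coeff smul Y \<omega> \<omega>b h hb a"
  have word: "word_sum (L 1) (Lb 1) i j a = (if i = 0 \<and> j = 0 then a else 0)" for i j
    using word_sum_eq[of "L 1" a "Lb 1"] a(2,3) L_zero_right Lb_zero_right by simp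
  have S: "?S i j = (if i = 0 \<and> j = 0 then smul (parity_sign (h - hb)) a else 0)" for i j
    by (simp add: S_coeff_def word)
  let ?t = "\<lambda>(i, j). form b (Y (?S i j) (p - 1 - real i + 2 * h) (q - 1 - real j + 2 * hb) c)"
  have lin: "Vector_Spaces.linear smul (*) (\<lambda>w. form b w)"
    using form by (simp add: invariant_bilinear_form_def)
  interpret lin: Vector_Spaces.linear smul "(*)" "\<lambda>w. form b w"
    by (rule lin)
  have "form (Y a (- p - 1) (- q - 1) b) c = (\<Sum>x | (case x of (i, j) \<Rightarrow> ?S i j \<noteq> 0). ?t x)"
    using form a(1) by (simp add: invariant_bilinear_form_def)
  also have "\<dots> = (\<Sum>x\<in>{(0, 0)}. ?t x)"
    by (rule sum.mono_neutral_left) (auto simp: S Y_left.zero lin.zero split: if_splits)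
  also have "\<dots> = parity_sign (h - hb) * form b (Y a (p - 1 + 2 * h) (q - 1 + 2 * hb) c)"
    by (simp add: S Y_left.scale lin.scale)
  finally show ?thesis .
qed

lemma conformal_form:
  assumes form: "invariant_bilinear_form smul F Y \<omega> \<omega>b form" and "nondegenerate_form form"
  shows "conformal_form smul F L Lb form"
proof (intro conformal_form.intro conformal_form_axioms.intro)
  show "vector_space smul"
    by (rule vector_space_axioms)
  show "form (L n v) w = form v (L (- n) w)" for n v w
    using quasi_primary_adjoint[OF form \<omega>_degree \<omega>_lowering(2) Lb_\<omega>[of 1], of "- of_int n - 2" 0 v w]
    by (simp add: L_op_def parity_sign_def algebra_simps)
  show "form (Lb n v) w = form v (Lb (- n) w)" for n v w
    using quasi_primary_adjoint[OF form \<omega>b_degree L_\<omega>b[of 1] \<omega>b_lowering(2), of 0 "- of_int n - 2" v w]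
    by (simp add: Lbar_op_def parity_sign_def algebra_simps)
  show "Vector_Spaces.linear smul (*) (\<lambda>v. form v w)" "Vector_Spaces.linear smul (*) (\<lambda>w. form v w)" for v w
    using form by (simp_all add: invariant_bilinear_form_def)
  show "subspace (F h hb)" for h hb
    by (rule subspace_F)
  show "span (\<Union>h hb. F h hb) = UNIV"
    by (rule span_homogeneous)
  show "\<exists>N. \<forall>h hb. h \<le> N \<or> hb \<le> N \<longrightarrow> F h hb = {0}"
    by (rule bounded_below)
  show "Vector_Spaces.linear smul smul (L n)" "Vector_Spaces.linear smul smul (Lb n)" for n
    by (rule linear_L linear_Lb)+
  show "L n v \<in> F (h - of_int n) hb" if "v \<in> F h hb" for n v h hb
    using that by (rule L_degree)
  show "Lb n v \<in> F h (hb - of_int n)" if "v \<in> F h hb" for n v h hb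
    using that by (rule Lb_degree)
  show "L 0 v = smul (of_real h) v" if "v \<in> F h hb" for v h hb
    using that by (rule L0)
  show "Lb 0 v = smul (of_real hb) v" if "v \<in> F h hb" for v h hb
    using that by (rule Lbar0)
  show "\<exists>c. virasoro_relations smul L c" "\<exists>c. virasoro_relations smul Lb c"
    by (rule virasoro virasoro_bar)+
  show "L n (Lb m v) = Lb m (L n v)" for n m v
    by (rule L_Lb_commute)
  show "nondegenerate_form form"
    by (rule assms(2))
qed

end

section \<open>Quasi-primary generation\<close>

context conformal_form
begin

lemma descendants_separate_swap:
  assumes "descendants_separate"
  shows "conformal_form.descendants_separate Lb L form"
proof -
  interpret swap: conformal_form smul "\<lambda>h hb. F hb h" Lb L form
    by (rule conformal_form_swap)
  show ?thesis
    using assms unfolding descendants_separate_def swap.descendants_separate_def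
      quasi_primary_def swap.quasi_primary_def L_power_Lb_power_commute by blast
qed

lemma descendants_separate_if_spanning:
  assumes "span {(L (- 1) ^^ i) ((Lb (- 1) ^^ j) x) | i j x. x \<in> Q} = UNIV"
    and Q: "\<And>x. x \<in> Q \<Longrightarrow> quasi_primary x"
  shows "descendants_separate"
  unfolding descendants_separate_def
proof (intro allI impI)
  fix w assume w: "\<forall>i j x. quasi_primary x \<longrightarrow> form w ((L (- 1) ^^ i) ((Lb (- 1) ^^ j) x)) = 0"
  have "form w v = 0" for v
  proof -
    have "v \<in> span {(L (- 1) ^^ i) ((Lb (- 1) ^^ j) x) | i j x. x \<in> Q}"
      using assms(1) by simp
    then show ?thesis
      by (induction rule: span_induct_alt)
        (use w Q in \<open>auto simp: form_right.add form_right.scale form_right.zero\<close>)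
  qed
  then show "w = 0"
    using nondegenerate by (simp add: nondegenerate_form_def)
qed

lemma quasi_primary_span:
  assumes "x \<in> span Q" "\<And>x. x \<in> Q \<Longrightarrow> quasi_primary x"
  shows "quasi_primary x"
  using assms(1) unfolding quasi_primary_def
  by (induction rule: span_induct_alt)
    (use assms(2) in \<open>auto simp: quasi_primary_def L.add L.scale L.zero Lb.add Lb.scale Lb.zero\<close>)

lemma conditions_if_descendants_separate:
  assumes sep: "descendants_separate"
  shows "h = of_int k / 2 \<or> hb = of_int k / 2 \<Longrightarrow> k < 0 \<Longrightarrow> F h hb = {0}"
    and "v \<in> F 1 hb \<Longrightarrow> L 1 v = 0" "v \<in> F h 1 \<Longrightarrow> Lb 1 v = 0"
    and "v \<in> F 0 hb \<Longrightarrow> L (- 1) v = 0" "v \<in> F h 0 \<Longrightarrow> Lb (- 1) v = 0"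
proof -
  interpret swap: conformal_form smul "\<lambda>h hb. F hb h" Lb L form
    by (rule conformal_form_swap)
  note sep' = descendants_separate_swap[OF sep]
  show "F h hb = {0}" if "h = of_int k / 2 \<or> hb = of_int k / 2" "k < 0"
  proof -
    have "of_int k / 2 = - real (Suc (nat (- k - 1))) / 2"
      using that(2) by simp
    then show ?thesis
      using that(1) negative_half_integer_zero[OF sep] swap.negative_half_integer_zero[OF sep']
      by metis
  qed
  show "v \<in> F 1 hb \<Longrightarrow> L 1 v = 0" "v \<in> F h 1 \<Longrightarrow> Lb 1 v = 0"
    by (rule L_one_weight_one[OF sep], assumption) (rule swap.L_one_weight_one[OF sep'], assumption)
  show "v \<in> F 0 hb \<Longrightarrow> L (- 1) v = 0" "v \<in> F h 0 \<Longrightarrow> Lb (- 1) v = 0"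
    by (rule L_minus_one_weight_zero[OF sep], assumption)
      (rule swap.L_minus_one_weight_zero[OF sep'], assumption)
qed

end

theorem proposition3p5:
  fixes smul :: "complex \<Rightarrow> 'v::ab_group_add \<Rightarrow> 'v"
    and F :: "real \<Rightarrow> real \<Rightarrow> 'v set"
    and Y :: "'v \<Rightarrow> real \<Rightarrow> real \<Rightarrow> 'v \<Rightarrow> 'v"
    and vac \<omega> \<omega>b :: 'v
  assumes "full_vertex_operator_algebra smul F Y vac \<omega> \<omega>b"
    and "self_dual smul F Y \<omega> \<omega>b"
  shows "QP_generated smul F Y \<omega> \<omega>b \<longleftrightarrow>
    (\<forall>h hb. (\<exists>k::int. k < 0 \<and> (h = of_int k / 2 \<or> hb = of_int k / 2)) \<longrightarrow> F h hb = {0}) \<and>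
    (\<forall>n::int. (\<forall>v\<in>F 1 (of_int n). L_op Y \<omega> 1 v = 0) \<and>
              (\<forall>v\<in>F (of_int n) 1. Lbar_op Y \<omega>b 1 v = 0)) \<and>
    (\<forall>n::int. (\<forall>v\<in>F 0 (of_int n). L_op Y \<omega> (- 1) v = 0) \<and>
              (\<forall>v\<in>F (of_int n) 0. Lbar_op Y \<omega>b (- 1) v = 0))"
proof -
  interpret full_vertex_operator_algebra smul F Y vac \<omega> \<omega>b
    by (rule assms(1))
  obtain form where "invariant_bilinear_form smul F Y \<omega> \<omega>b form" "nondegenerate_form form"
    using assms(2) unfolding self_dual_def by blast
  then interpret conf: conformal_form smul F "L_op Y \<omega>" "Lbar_op Y \<omega>b" form
    by (rule conformal_form)
  define Q where "Q = (\<Union>h hb. QF_component F Y \<omega> \<omega>b h hb)"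
  have QF: "QF smul F Y \<omega> \<omega>b = span Q"
    by (simp add: QF_def Q_def)
  have Q: "x \<in> Q \<longleftrightarrow> (\<exists>h hb. x \<in> F h hb \<and> conf.quasi_primary x)" for x
    by (auto simp: Q_def QF_component_def conf.quasi_primary_def)
  show ?thesis
  proof (intro iffI)
    assume "QP_generated smul F Y \<omega> \<omega>b"
    then have sep: "conf.descendants_separate"
      unfolding QP_generated_def QF
      by (rule conf.descendants_separate_if_spanning) (use Q in \<open>blast intro: conf.quasi_primary_span\<close>)
    note conditions = conf.conditions_if_descendants_separate[OF sep]
    show "(\<forall>h hb. (\<exists>k::int. k < 0 \<and> (h = of_int k / 2 \<or> hb = of_int k / 2)) \<longrightarrow> F h hb = {0}) \<and>
      (\<forall>n::int. (\<forall>v\<in>F 1 (of_int n). L 1 v = 0) \<and> (\<forall>v\<in>F (of_int n) 1. Lb 1 v = 0)) \<and>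
      (\<forall>n::int. (\<forall>v\<in>F 0 (of_int n). L (- 1) v = 0) \<and> (\<forall>v\<in>F (of_int n) 0. Lb (- 1) v = 0))"
      using conditions(1) by (intro conjI allI impI ballI; (elim exE conjE)?) (blast intro: conditions(2-5))+
  next
    assume "(\<forall>h hb. (\<exists>k::int. k < 0 \<and> (h = of_int k / 2 \<or> hb = of_int k / 2)) \<longrightarrow> F h hb = {0}) \<and>
      (\<forall>n::int. (\<forall>v\<in>F 1 (of_int n). L 1 v = 0) \<and> (\<forall>v\<in>F (of_int n) 1. Lb 1 v = 0)) \<and>
      (\<forall>n::int. (\<forall>v\<in>F 0 (of_int n). L (- 1) v = 0) \<and> (\<forall>v\<in>F (of_int n) 0. Lb (- 1) v = 0))"
    then have zero: "\<And>h hb k. k < 0 \<Longrightarrow> h = of_int k / 2 \<or> hb = of_int k / 2 \<Longrightarrow> F h hb = {0}"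
      and L_one: "\<And>n v. v \<in> F 1 (of_int n) \<Longrightarrow> L 1 v = 0"
      and Lb_one: "\<And>n v. v \<in> F (of_int n) 1 \<Longrightarrow> Lb 1 v = 0"
      by blast+
    have "span {(L (- 1) ^^ i) ((Lb (- 1) ^^ j) x) | i j x.
        \<exists>h hb. x \<in> F h hb \<and> conf.quasi_primary x} = UNIV"
    proof (rule conf.spanned_by_descendants)
      show "F h hb = {0}" if "h = - real (Suc m) / 2 \<or> hb = - real (Suc m) / 2" for m h hb
        using that by (intro zero[of "- int (Suc m)"]) simp_all
      \<comment> \<open>the condition in weight 1 is stated for integral conjugate weight; otherwise the space is zero\<close>
      show "L 1 v = 0" if v: "v \<in> F 1 hb" for v hb
      proof (cases "1 - hb \<in> \<int>")
        case True
        then have "hb \<in> \<int>"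
          using Ints_diff[of 1 "1 - hb"] by simp
        then show ?thesis
          using v L_one by (elim Ints_cases) simp
      next
        case False
        then show ?thesis
          using v FV2 L_zero_right by fastforce
      qed
      show "Lb 1 v = 0" if v: "v \<in> F h 1" for v h
      proof (cases "h - 1 \<in> \<int>")
        case True
        then have "h \<in> \<int>"
          using Ints_add[of "h - 1" 1] by simp
        then show ?thesis
          using v Lb_one by (elim Ints_cases) simp
      next
        case False
        then show ?thesis
          using v FV2 Lb_zero_right by fastforce
      qed
    qed
    then have spanning: "UNIV \<subseteq> span {(L (- 1) ^^ i) ((Lb (- 1) ^^ j) x) | i j x.
        \<exists>h hb. x \<in> F h hb \<and> conf.quasi_primary x}"
      by (rule equalityD2)
    have "{(L (- 1) ^^ i) ((Lb (- 1) ^^ j) x) | i j x. \<exists>h hb. x \<in> F h hb \<and> conf.quasi_primary x} \<subseteq>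
        {(L (- 1) ^^ i) ((Lb (- 1) ^^ j) x) | i j x. x \<in> span Q}"
      using Q span_base by blast
    from span_mono[OF this] have "UNIV \<subseteq> span {(L (- 1) ^^ i) ((Lb (- 1) ^^ j) x) | i j x. x \<in> span Q}"
      by (rule subset_trans[OF spanning])
    then show "QP_generated smul F Y \<omega> \<omega>b"
      unfolding QP_generated_def QF by blast
  qed
qed

end
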